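(* Let $n\in\mathbb N$ (positive integer). In the vertex operator algebra $N_2(n-2,0)$ the vector $$v_{2,n}=\sum_{t=0}^{2n}\frac1{t!}\,e_{\epsilon_1-\epsilon_3}(-1)^t\,e_{\epsilon_2-\epsilon_3}(-1)^{2n-t}\,f_{\epsilon_1-\epsilon_2}(0)^t\,e_{\epsilon_1-\epsilon_2}(-1)^n\mathbf 1$$ is a singular vector.
   Context: $\mathfrak g=\mathfrak{sl}_3(\mathbb C)$ with Cartan subalgebra of traceless diagonal matrices, simple roots $\alpha_1=\epsilon_1-\epsilon_2$, $\alpha_2=\epsilon_2-\epsilon_3$, highest root $\theta=\epsilon_1-\epsilon_3$. Root vectors: $e_{\epsilon_1-\epsilon_2}=E_{12}$, $e_{\epsilon_2-\epsilon_3}=E_{23}$, $e_{\epsilon_1-\epsilon_3}=-E_{13}$, $f_{\epsilon_1-\epsilon_2}=E_{21}$, $f_{\epsilon_2-\epsilon_3}=E_{32}$, $f_{\epsilon_1-\epsilon_3}=-E_{31}$ (so $[e_{\epsilon_1-\epsilon_2},e_{\epsilon_2-\epsilon_3}]=-e_{\epsilon_1-\epsilon_3}$). The affine Lie algebra $\hat{\mathfrak g}=\mathfrak g\otimes\mathbb C[t,t^{-1}]\oplus\mathbb Cc$ has bracket $[x(m),y(n)]=[x,y](m+n)+m\delta_{m+n,0}\operatorname{tr}(xy)c$, $x(m)=x\otimes t^m$. $N_2(k,0)=U(\hat{\mathfrak g})\otimes_{U(\mathfrak g\otimes\mathbb C[t]\oplus\mathbb Cc)}\mathbb C$ with $\mathfrak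 g\otimes\mathbb C[t]$ acting by $0$ and $c$ by $k$; it is a vertex operator algebra for $k\neq -3$, with vacuum $\mathbf 1=1\otimes 1$. A singular vector is a weight vector annihilated by $\mathfrak n_+\otimes 1$ and $\mathfrak g\otimes t\mathbb C[t]$ (equivalently by $e_{\alpha_1}(0),e_{\alpha_2}(0),f_\theta(1)$). *)

theory Defs
  imports "HOL-Analysis.Analysis"
begin

text \<open>Matrix indices are the elements 0,1,2 of the numeral type 3; the paper's
index i (1,2,3) corresponds to i-1 here.\<close>

definition Emat :: "3 \<Rightarrow> 3 \<Rightarrow> complex^3^3" where
  "Emat i j = (\<chi> a b. if a = i \<and> b = j then 1 else 0)"

definition msc :: "complex \<Rightarrow> complex^3^3 \<Rightarrow> complex^3^3" where
  "msc c x = (\<chi> a b. c * x$a$b)"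

definition sl3 :: "(complex^3^3) set" where
  "sl3 = {x. trace x = 0}"

definition lbr :: "complex^3^3 \<Rightarrow> complex^3^3 \<Rightarrow> complex^3^3" where
  "lbr x y = x ** y - y ** x"

definition cartan :: "(complex^3^3) set" where
  "cartan = {h \<in> sl3. \<forall>i j. i \<noteq> j \<longrightarrow> h$i$j = 0}"

definition nplus :: "(complex^3^3) set" where
  "nplus = {x. \<forall>i j. j \<le> i \<longrightarrow> x$i$j = 0}"

definition e12 :: "complex^3^3" where "e12 = Emat 0 1"
definition e23 :: "complex^3^3" where "e23 = Emat 1 2"
definition e13 :: "complex^3^3" where "e13 = msc (-1) (Emat 0 2)"
definition f12 :: "complex^3^3" where "f12 = Emat 1 0"

section \<open>The tensor algebra on generators x(m), c (formal noncommutative polynomials)\<close>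

datatype gen = G "complex^3^3" int | Cc

type_synonym elt = "gen list \<Rightarrow> complex"

definition fin :: "elt \<Rightarrow> bool" where
  "fin p \<longleftrightarrow> finite {w. p w \<noteq> 0}"

definition mon :: "gen list \<Rightarrow> elt" where
  "mon w = (\<lambda>u. if u = w then 1 else 0)"

definition fmul :: "elt \<Rightarrow> elt \<Rightarrow> elt" where
  "fmul p q = (\<lambda>w. \<Sum>i\<le>length w. p (take i w) * q (drop i w))"

definition fadd :: "elt \<Rightarrow> elt \<Rightarrow> elt" where
  "fadd p q = (\<lambda>w. p w + q w)"

definition fsub :: "elt \<Rightarrow> elt \<Rightarrow> elt" where
  "fsub p q = (\<lambda>w. p w - q w)"

definition fsmul :: "complex \<Rightarrow> elt \<Rightarrow> elt" where
  "fsmul c p = (\<lambda>w. c * p w)"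

definition fzero :: elt where
  "fzero = (\<lambda>w. 0)"

definition gm :: "complex^3^3 \<Rightarrow> int \<Rightarrow> elt" where
  "gm x m = mon [G x m]"

definition cc :: elt where
  "cc = mon [Cc]"

text \<open>Defining relations of U(affine sl_3): linearity of x \<mapsto> x(m) on sl_3,
generators x(m) with x not traceless are killed (they are not part of sl_3),
the affine bracket, and centrality of c.\<close>
definition rels :: "elt set" where
  "rels =
     {fsub (gm (msc a x + msc b y) m) (fadd (fsmul a (gm x m)) (fsmul b (gm y m))) |
        a b x y m. x \<in> sl3 \<and> y \<in> sl3}
   \<union> {gm x m | x m. x \<notin> sl3}
   \<union> {fsub (fsub (fmul (gm x m) (gm y n)) (fmul (gm y n) (gm x m)))
           (fadd (gm (lbr x y) (m + n))
                 (fsmul (if m + n = 0 then of_int m * trace (x ** y) else 0) cc)) |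
        x y m n. x \<in> sl3 \<and> y \<in> sl3}
   \<union> {fsub (fmul cc (gm x m)) (fmul (gm x m) cc) | x m. True}"

text \<open>Annihilator of the vacuum: g \<otimes> C[t] acts by 0, c acts by k.\<close>
definition anns :: "complex \<Rightarrow> elt set" where
  "anns k = {gm x m | x m. x \<in> sl3 \<and> m \<ge> 0} \<union> {fsub cc (fsmul k (mon []))}"

text \<open>Preimage in the tensor algebra T of the left ideal U(g^)\<cdot>(annihilator):
  the two-sided ideal of relations plus the left ideal generated by anns k.
  Then N_2(k,0) = T / Nid k and the class of a is a\<cdot>1.\<close>
inductive_set Nid :: "complex \<Rightarrow> elt set" for k :: complex where
  zero: "fzero \<in> Nid k"
| rel: "r \<in> rels \<Longrightarrow> fin a \<Longrightarrow> fin b \<Longrightarrow> fmul (fmul a r) b \<in> Nid k"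
| ann: "g \<in> anns k \<Longrightarrow> fin a \<Longrightarrow> fmul a g \<in> Nid k"
| add: "p \<in> Nid k \<Longrightarrow> q \<in> Nid k \<Longrightarrow> fadd p q \<in> Nid k"

text \<open>Singular vector in N_2(k,0), represented by a (finitely supported) element v of T
  (meaning the vector v\<cdot>1): a nonzero weight vector annihilated by n_+ \<otimes> 1 and
  by g \<otimes> tC[t].\<close>
definition singular_vector :: "complex \<Rightarrow> elt \<Rightarrow> bool" where
  "singular_vector k v \<longleftrightarrow>
     fin v \<and> v \<notin> Nid k \<and>
     (\<exists>wt::complex^3^3 \<Rightarrow> complex. \<forall>h\<in>cartan.
         fsub (fmul (gm h 0) v) (fsmul (wt h) v) \<in> Nid k) \<and>
     (\<forall>x\<in>nplus. fmul (gm x 0) v \<in> Nid k) \<and>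
     (\<forall>x\<in>sl3. \<forall>m::int. m \<ge> 1 \<longrightarrow> fmul (gm x m) v \<in> Nid k)"

definition v2 :: "nat \<Rightarrow> elt" where
  "v2 n = (\<lambda>w. \<Sum>t\<in>{0..2*n}.
      (1 / of_nat (fact t)) *
      mon (replicate t (G e13 (-1)) @ replicate (2*n - t) (G e23 (-1)) @
           replicate t (G f12 0) @ replicate n (G e12 (-1))) w)"

end

theory Submission
  imports Defs "HOL-Library.Poly_Mapping"
begin

text \<open>
  Annihilation: commuting \<open>e\<^sub>1\<^sub>2(0)\<close>, \<open>e\<^sub>2\<^sub>3(0)\<close> and \<open>E\<^sub>3\<^sub>1(1)\<close> through a summand of the vector
  produces two words, one of which is proportional to a word coming from the next summand. For
  \<open>e\<^sub>1\<^sub>2(0)\<close> everything cancels; for \<open>e\<^sub>2\<^sub>3(0)\<close> the last word remains, but it contains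
  \<open>f\<^sub>1\<^sub>2(0)\<^bsup>2n\<^esup> e\<^sub>1\<^sub>2(-1)\<^bsup>n-1\<^esup>\<one> = 0\<close>; for \<open>E\<^sub>3\<^sub>1(1)\<close> the outcome is a multiple of \<open>n - 2 - c\<close>. These
  three elements generate \<open>\<nn>\<^sub>+ \<otimes> 1\<close> and \<open>\<gg> \<otimes> t\<complex>[t]\<close>.

  Nonvanishing: instead of a Poincare-Birkhoff-Witt theorem, a linear functional on the vacuum
  module is used. The affine Lie algebra acts (as an anti-representation) on the polynomial
  functions on the big cell of the Sato Grassmannian, level \<open>k\<close> entering through a zeroth order
  term, and a word \<open>w\<close> is sent to the value at the origin of \<open>w\<close> applied to a polynomial \<open>P\<close>. There
  \<open>x(-1)\<close> acts on the coordinates \<open>z\<^sub>i\<^sub>j\<close> of the lowest block as the constant vector field \<open>x\<close>, so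
  that for \<open>P = z\<^sub>1\<^sub>2\<^bsup>n\<^esup> z\<^sub>2\<^sub>3\<^bsup>2n\<^esup>\<close> only the summand \<open>t = 0\<close> contributes, with value \<open>(2n)! n!\<close>.
\<close>

section \<open>The tensor algebra\<close>

lemma fmul_fadd_left: "fmul (fadd p q) r = fadd (fmul p r) (fmul q r)"
  by (simp add: fmul_def fadd_def fun_eq_iff sum.distrib algebra_simps)

lemma fmul_fadd_right: "fmul r (fadd p q) = fadd (fmul r p) (fmul r q)"
  by (simp add: fmul_def fadd_def fun_eq_iff sum.distrib algebra_simps)

lemma fmul_fsub_left: "fmul (fsub p q) r = fsub (fmul p r) (fmul q r)"
  by (simp add: fmul_def fsub_def fun_eq_iff sum_subtractf algebra_simps)

lemma fmul_fsub_right: "fmul r (fsub p q) = fsub (fmul r p) (fmul r q)"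
  by (simp add: fmul_def fsub_def fun_eq_iff sum_subtractf algebra_simps)

lemma fmul_fsmul_left: "fmul (fsmul c p) r = fsmul c (fmul p r)"
  by (simp add: fmul_def fsmul_def fun_eq_iff sum_distrib_left algebra_simps)

lemma fmul_fsmul_right: "fmul r (fsmul c p) = fsmul c (fmul r p)"
  by (simp add: fmul_def fsmul_def fun_eq_iff sum_distrib_left algebra_simps)

lemma fmul_fzero [simp]: "fmul fzero r = fzero" "fmul r fzero = fzero"
  by (simp_all add: fmul_def fzero_def)

lemma fmul_assoc: "fmul (fmul p q) r = fmul p (fmul q r)"
proof
  fix w :: "gen list"
  define N where "N = length w"
  have "fmul (fmul p q) r w =
      (\<Sum>i\<le>N. \<Sum>j\<le>i. p (take j w) * q (drop j (take i w)) * r (drop i w))"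
    unfolding fmul_def N_def sum_distrib_right by (intro sum.cong) (auto simp: min_def)
  also have "\<dots> = (\<Sum>i\<le>N. \<Sum>j\<in>{j\<in>{..N}. j \<le> i}. p (take j w) * q (drop j (take i w)) * r (drop i w))"
    by (intro sum.cong) auto
  also have "\<dots> = (\<Sum>j\<le>N. \<Sum>i\<in>{i\<in>{..N}. j \<le> i}. p (take j w) * q (drop j (take i w)) * r (drop i w))"
    by (rule sum.swap_restrict) auto
  also have "\<dots> = (\<Sum>j\<le>N. \<Sum>i\<le>N - j. p (take j w) * q (take i (drop j w)) * r (drop i (drop j w)))"
  proof (rule sum.cong[OF refl], goal_cases)
    case (1 j)
    then show ?case
      by (intro sum.reindex_bij_witness[of _ "\<lambda>i. i + j" "\<lambda>i. i - j"])
         (auto simp: drop_take)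
  qed
  also have "\<dots> = fmul p (fmul q r) w"
    by (simp add: fmul_def N_def sum_distrib_left mult.assoc)
  finally show "fmul (fmul p q) r w = fmul p (fmul q r) w" .
qed

lemma fmul_mon: "fmul (mon u) (mon v) = mon (u @ v)"
proof
  fix w
  have "fmul (mon u) (mon v) w =
      (\<Sum>i\<le>length w. if i = length u then (if w = u @ v then 1 else 0) else 0)"
    unfolding fmul_def
  proof (intro sum.cong refl)
    fix i assume "i \<in> {..length w}"
    then have "take i w = u \<and> drop i w = v \<longleftrightarrow> i = length u \<and> w = u @ v"
      by (auto simp: min_def)
    moreover have "mon u (take i w) * mon v (drop i w) =
        (if take i w = u \<and> drop i w = v then 1 else 0)"
      by (simp add: mon_def)
    ultimately show "mon u (take i w) * mon v (drop i w) =
        (if i = length u then if w = u @ v then 1 else 0 else 0)"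
      by presburger
  qed
  then show "fmul (mon u) (mon v) w = mon (u @ v) w"
    by (auto simp: mon_def)
qed

lemma fmul_mon_Nil [simp]: "fmul (mon []) p = p" "fmul p (mon []) = p"
proof -
  have "fmul (mon []) p w = (\<Sum>i\<le>length w. if i = 0 then p w else 0)" for w
    unfolding fmul_def mon_def by (intro sum.cong) auto
  then show "fmul (mon []) p = p"
    by (simp add: fun_eq_iff)
  have "fmul p (mon []) w = (\<Sum>i\<le>length w. if i = length w then p w else 0)" for w
    unfolding fmul_def mon_def by (intro sum.cong) auto
  then show "fmul p (mon []) = p"
    by (simp add: fun_eq_iff)
qed

lemma fin_fzero [simp]: "fin fzero"
  by (simp add: fin_def fzero_def)

lemma fin_mon [simp]: "fin (mon w)"
  by (simp add: fin_def mon_def)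

lemma fin_gm [simp]: "fin (gm x m)" and fin_cc [simp]: "fin cc"
  by (simp_all add: gm_def cc_def)

lemma fin_fadd [simp]: "fin p \<Longrightarrow> fin q \<Longrightarrow> fin (fadd p q)"
  unfolding fin_def fadd_def
  by (rule finite_subset[of _ "{w. p w \<noteq> 0} \<union> {w. q w \<noteq> 0}"]) auto

lemma fin_fsub [simp]: "fin p \<Longrightarrow> fin q \<Longrightarrow> fin (fsub p q)"
  unfolding fin_def fsub_def
  by (rule finite_subset[of _ "{w. p w \<noteq> 0} \<union> {w. q w \<noteq> 0}"]) auto

lemma fin_fsmul [simp]: "fin p \<Longrightarrow> fin (fsmul c p)"
  unfolding fin_def fsmul_def
  by (rule finite_subset[of _ "{w. p w \<noteq> 0}"]) auto

lemma fin_fmul [simp]: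
  assumes "fin p" "fin q"
  shows "fin (fmul p q)"
proof -
  have "{w. fmul p q w \<noteq> 0} \<subseteq> (\<lambda>(u, v). u @ v) ` ({w. p w \<noteq> 0} \<times> {w. q w \<noteq> 0})"
  proof
    fix w assume "w \<in> {w. fmul p q w \<noteq> 0}"
    then obtain i where "p (take i w) * q (drop i w) \<noteq> 0"
      unfolding fmul_def by (auto elim: sum.not_neutral_contains_not_neutral)
    then show "w \<in> (\<lambda>(u, v). u @ v) ` ({w. p w \<noteq> 0} \<times> {w. q w \<noteq> 0})"
      by (intro image_eqI[of _ _ "(take i w, drop i w)"]) auto
  qed
  with assms show ?thesis
    unfolding fin_def by (meson finite_SigmaI finite_imageI finite_subset)
qed

lemma fin_induct [consumes 1, case_names zero add]:
  assumes "fin p" and zero: "P fzero"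
    and add: "\<And>c w q. fin q \<Longrightarrow> P q \<Longrightarrow> P (fadd (fsmul c (mon w)) q)"
  shows "P p"
proof -
  have "\<forall>p. {w. p w \<noteq> 0} \<subseteq> S \<longrightarrow> P p" if "finite S" for S
    using that
  proof (induction S rule: finite_induct)
    case empty
    have "p = fzero" if "{w. p w \<noteq> 0} \<subseteq> {}" for p :: elt
      using that by (auto simp: fzero_def)
    with zero show ?case by metis
  next
    case (insert w S)
    show ?case
    proof (intro allI impI)
      fix p :: elt assume *: "{w. p w \<noteq> 0} \<subseteq> insert w S"
      define q where "q = p(w := 0)"
      have sub: "{w. q w \<noteq> 0} \<subseteq> S"
        using * by (auto simp: q_def)
      then have "fin q"
        using insert.hyps(1) unfolding fin_def by (rule finite_subset)
      moreover have "p = fadd (fsmul (p w) (mon w)) q"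
        by (auto simp: q_def fadd_def fsmul_def mon_def)
      ultimately show "P p"
        using insert.IH sub add by metis
    qed
  qed
  with assms(1) show ?thesis
    by (auto simp: fin_def)
qed

section \<open>The submodule of relations and vacuum conditions\<close>

lemma fin_rels: "r \<in> rels \<Longrightarrow> fin r"
  by (auto simp: rels_def)

lemma fin_anns: "g \<in> anns k \<Longrightarrow> fin g"
  by (auto simp: anns_def)

lemma fin_Nid: "p \<in> Nid k \<Longrightarrow> fin p"
  by (induction rule: Nid.induct) (auto simp: fin_rels fin_anns)

text \<open>A left factor is absorbed into the left factor of each generator, so the quotient by
  \<open>Nid k\<close> is a left module over the tensor algebra.\<close>

lemma fmul_Nid:
  assumes "p \<in> Nid k" "fin a"
  shows "fmul a p \<in> Nid k"
  using assms(1)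
proof induction
  case zero
  then show ?case by (simp add: Nid.zero)
next
  case (rel r x y)
  then show ?case
    using Nid.rel[of r "fmul a x" y k] assms(2) by (simp add: fmul_assoc)
next
  case (ann g x)
  then show ?case
    using Nid.ann[of g k "fmul a x"] assms(2) by (simp add: fmul_assoc)
next
  case (add p q)
  then show ?case
    by (simp add: fmul_fadd_right Nid.add)
qed

text \<open>Scaling is not among the rules generating \<open>Nid\<close>; it is left multiplication
  by a multiple of the empty word.\<close>

lemma fsmul_Nid:
  assumes "p \<in> Nid k"
  shows "fsmul c p \<in> Nid k"
  using fmul_Nid[OF assms, of "fsmul c (mon [])"] by (simp add: fmul_fsmul_left)

lemma fsub_Nid:
  assumes "p \<in> Nid k" "q \<in> Nid k"
  shows "fsub p q \<in> Nid k"
proof -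
  have "fsub p q = fadd p (fsmul (-1) q)"
    by (simp add: fsub_def fadd_def fsmul_def)
  with assms show ?thesis
    by (simp add: Nid.add fsmul_Nid)
qed

section \<open>Derivations of polynomial rings\<close>

text \<open>Monomials are multisets of variables with multiset sum as product, so convolution of
  finitely supported functions is multiplication of polynomials in arbitrarily many
  variables.\<close>

type_synonym 'v mpol = "'v multiset \<Rightarrow>\<^sub>0 complex"

definition Cst :: "complex \<Rightarrow> 'v mpol" where
  "Cst c = Poly_Mapping.single 0 c"

definition Var :: "'v \<Rightarrow> 'v mpol" where
  "Var v = Poly_Mapping.single {#v#} 1"

lemma Cst_0 [simp]: "Cst 0 = 0" and Cst_1 [simp]: "Cst 1 = 1"
  by (simp_all add: Cst_def)

lemma Cst_add: "Cst (a + b) = Cst a + Cst b"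
  and Cst_diff: "Cst (a - b) = Cst a - Cst b"
  and Cst_minus: "Cst (- a) = - Cst a"
  and Cst_mult: "Cst (a * b) = Cst a * Cst b"
  by (simp_all add: Cst_def single_add single_diff single_uminus mult_single)

lemma Cst_sum: "Cst (sum f A) = (\<Sum>i\<in>A. Cst (f i))"
  by (induction A rule: infinite_finite_induct) (simp_all add: Cst_add)

lemma mpol_single_induct [case_names zero add]:
  assumes "P 0" "\<And>M c p. P p \<Longrightarrow> P (Poly_Mapping.single M c + p)"
  shows "P (p :: 'v mpol)"
proof (induction p rule: Poly_Mapping.update_induct)
  case const
  show ?case by fact
next
  case (update f a b)
  have "Poly_Mapping.update a b f = Poly_Mapping.single a b + f"
    using update.hyps(1)
    by (intro poly_mapping_eqI) (auto simp: lookup_update lookup_add lookup_single when_def in_keys_iff)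
  with update.IH assms(2) show ?case
    by metis
qed

lemma single_eq_Cst_mult: "Poly_Mapping.single M c = Cst c * Poly_Mapping.single M 1"
  by (simp add: Cst_def mult_single)

lemma single_add_mset: "Poly_Mapping.single (add_mset v M) 1 = Var v * Poly_Mapping.single M 1"
  by (simp add: Var_def mult_single)

lemma mpol_induct [case_names Cst Var add mult]:
  assumes "\<And>c. P (Cst c)" "\<And>v. P (Var v)"
    and "\<And>p q. P p \<Longrightarrow> P q \<Longrightarrow> P (p + q)" "\<And>p q. P p \<Longrightarrow> P q \<Longrightarrow> P (p * q)"
  shows "P (p :: 'v mpol)"
proof -
  have "P (Poly_Mapping.single M 1)" for M
  proof (induction M)
    case empty
    then show ?case using assms(1)[of 1] by simp
  next
    case (add v M)
    then show ?case unfolding single_add_mset by (intro assms)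
  qed
  then have single: "P (Poly_Mapping.single M c)" for M c
    by (subst single_eq_Cst_mult) (intro assms)
  show ?thesis
  proof (induction p rule: mpol_single_induct)
    case zero
    then show ?case using assms(1)[of 0] by simp
  qed (intro assms single)
qed

text \<open>The Leibniz rule on a monomial. Summation over a multiset repeats each variable
  according to its multiplicity, which produces the exponent.\<close>

definition dmon :: "('v \<Rightarrow> 'v mpol) \<Rightarrow> 'v multiset \<Rightarrow> 'v mpol" where
  "dmon f M = (\<Sum>v\<in>#M. Poly_Mapping.single (M - {#v#}) 1 * f v)"

definition der :: "('v \<Rightarrow> 'v mpol) \<Rightarrow> 'v mpol \<Rightarrow> 'v mpol" where
  "der f p = (\<Sum>M\<in>Poly_Mapping.keys p. Cst (Poly_Mapping.lookup p M) * dmon f M)"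

lemma dmon_plus:
  "dmon f (M + N) = dmon f M * Poly_Mapping.single N 1 + Poly_Mapping.single M 1 * dmon f N"
proof -
  have 1: "(\<Sum>v\<in>#M. Poly_Mapping.single (M + N - {#v#}) 1 * f v) = dmon f M * Poly_Mapping.single N 1" for M N
  proof -
    have "(\<Sum>v\<in>#M. Poly_Mapping.single (M + N - {#v#}) 1 * f v) =
        (\<Sum>v\<in>#M. Poly_Mapping.single (M - {#v#}) 1 * f v * Poly_Mapping.single N 1)"
    proof (rule arg_cong[of _ _ sum_mset], rule image_mset_cong)
      fix v assume "v \<in># M"
      then have "M + N - {#v#} = (M - {#v#}) + N"
        by simp
      then have "Poly_Mapping.single (M + N - {#v#}) (1::complex) =
          Poly_Mapping.single (M - {#v#}) 1 * Poly_Mapping.single N 1"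
        by (simp add: mult_single)
      then show "Poly_Mapping.single (M + N - {#v#}) 1 * f v =
          Poly_Mapping.single (M - {#v#}) 1 * f v * Poly_Mapping.single N 1"
        by (simp add: mult_ac)
    qed
    then show ?thesis
      by (simp add: dmon_def sum_mset_distrib_right)
  qed
  show ?thesis
    using 1[of M N] 1[of N M] by (simp add: dmon_def add.commute mult.commute)
qed

lemma der_superset:
  assumes "finite S" "Poly_Mapping.keys p \<subseteq> S"
  shows "der f p = (\<Sum>M\<in>S. Cst (Poly_Mapping.lookup p M) * dmon f M)"
  unfolding der_def
  by (rule sum.mono_neutral_left) (use assms in \<open>auto simp: in_keys_iff\<close>)

lemma der_add: "der f (p + q) = der f p + der f q"
proof -
  let ?S = "Poly_Mapping.keys p \<union> Poly_Mapping.keys q"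
  have "der f (p + q) = (\<Sum>M\<in>?S. Cst (Poly_Mapping.lookup (p + q) M) * dmon f M)"
    by (rule der_superset) (simp_all add: keys_add)
  also have "\<dots> = (\<Sum>M\<in>?S. Cst (Poly_Mapping.lookup p M) * dmon f M) + (\<Sum>M\<in>?S. Cst (Poly_Mapping.lookup q M) * dmon f M)"
    by (simp add: lookup_add Cst_add distrib_right sum.distrib)
  also have "\<dots> = der f p + der f q"
    by (simp add: der_superset[of ?S])
  finally show ?thesis .
qed

lemma der_single: "der f (Poly_Mapping.single M c) = Cst c * dmon f M"
  by (cases "c = 0") (simp_all add: der_def)

lemma der_0 [simp]: "der f 0 = 0"
  by (simp add: der_def)

lemma der_mult: "der f (p * q) = der f p * q + p * der f q"
proof (induction p rule: mpol_single_induct)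
  case (add M c p)
  have "der f (Poly_Mapping.single M c * q) =
      der f (Poly_Mapping.single M c) * q + Poly_Mapping.single M c * der f q"
  proof (induction q rule: mpol_single_induct)
    case (add N d q)
    have "der f (Poly_Mapping.single M c * Poly_Mapping.single N d) =
        Cst c * Cst d * dmon f (M + N)"
      by (simp add: mult_single der_single Cst_mult)
    also have "\<dots> = der f (Poly_Mapping.single M c) * Poly_Mapping.single N d +
        Poly_Mapping.single M c * der f (Poly_Mapping.single N d)"
      unfolding der_single dmon_plus
      by (simp add: single_eq_Cst_mult[of M c] single_eq_Cst_mult[of N d] algebra_simps)
    finally show ?case
      using add by (simp add: der_add algebra_simps)
  qed simp
  then show ?case
    using add by (simp add: der_add algebra_simps)
qed simp

lemma der_Cst [simp]: "der f (Cst c) = 0"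
  by (simp add: Cst_def der_single dmon_def)

lemma der_1 [simp]: "der f 1 = 0"
  using der_Cst[of f 1] by simp

lemma der_Var [simp]: "der f (Var v) = f v"
  by (simp add: Var_def der_single dmon_def)

lemma der_Cst_mult: "der f (Cst c * p) = Cst c * der f p"
  by (simp add: der_mult)

lemma der_minus: "der f (- p) = - der f p"
  using der_Cst_mult[of f "-1" p] by (simp add: Cst_minus)

lemma der_sum: "der f (sum g A) = (\<Sum>i\<in>A. der f (g i))"
  by (induction A rule: infinite_finite_induct) (simp_all add: der_add)

text \<open>The commutator of two derivations is again a derivation, so it is determined by its
  values on the variables.\<close>

lemma der_commutator:
  assumes "\<And>v. der f (g v) - der g (f v) = h v"
  shows "der f (der g p) - der g (der f p) = der h p"
proof (induction p rule: mpol_induct)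
  case (add p q)
  have "der f (der g (p + q)) - der g (der f (p + q)) =
      (der f (der g p) - der g (der f p)) + (der f (der g q) - der g (der f q))"
    by (simp add: der_add)
  then show ?case
    by (simp add: add der_add)
next
  case (mult p q)
  have "der f (der g (p * q)) - der g (der f (p * q)) =
      (der f (der g p) - der g (der f p)) * q + p * (der f (der g q) - der g (der f q))"
    by (simp add: der_mult der_add algebra_simps)
  then show ?case
    by (simp add: mult der_mult)
qed (simp_all add: assms)

definition const_term :: "'v mpol \<Rightarrow> complex" where
  "const_term p = Poly_Mapping.lookup p 0"

lemma const_term_0 [simp]: "const_term 0 = 0"
  and const_term_add: "const_term (p + q) = const_term p + const_term q"
  and const_term_minus: "const_term (- p) = - const_term p"
  and const_term_single: "const_term (Poly_Mapping.single M c) = (if M = {#} then c else 0)"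
  by (simp_all add: const_term_def lookup_add lookup_single when_def)

lemma const_term_mult: "const_term (p * q) = const_term p * const_term q"
proof (induction p rule: mpol_single_induct)
  case (add M c p)
  have "const_term (Poly_Mapping.single M c * q) = const_term (Poly_Mapping.single M c) * const_term q"
    by (induction q rule: mpol_single_induct)
       (auto simp: distrib_left const_term_add mult_single const_term_single)
  with add show ?case
    by (simp add: distrib_right const_term_add)
qed simp

lemma const_term_Cst [simp]: "const_term (Cst c) = c" and const_term_Var [simp]: "const_term (Var v) = 0"
  by (simp_all add: Cst_def Var_def const_term_single)

lemma const_term_der:
  assumes "\<And>v. const_term (f v) = 0"
  shows "const_term (der f p) = 0"
  by (induction p rule: mpol_induct)
     (simp_all add: assms der_add der_mult const_term_add const_term_mult)


lemma const_term_sum: "const_term (sum f A) = (\<Sum>i\<in>A. const_term (f i))"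
  by (induction A rule: infinite_finite_induct) (simp_all add: const_term_add)

section \<open>Vector fields on the big cell of the Sato Grassmannian\<close>

text \<open>A point of the big cell is the graph of a matrix \<open>Z\<close> with rows indexed by \<open>P\<close>, \<open>fst P < 0\<close>, and
  columns indexed by \<open>Q\<close>, \<open>fst Q \<ge> 0\<close>. With \<open>E = (1, -Z)\<close> (\<open>Erow\<close>) and \<open>J\<close> the block column
  \<open>(Z, 1)\<close>, the matrix \<open>X\<close> moves \<open>Z\<close> by \<open>E X J\<close> (\<open>Vf\<close>); \<open>lin\<close> is the trace of \<open>X Z\<close>. For \<open>X = x(m)\<close> all
  infinite sums have finite support, and \<open>neg N\<close> is a window that contains it.\<close>

type_synonym idx = "int \<times> 3"
type_synonym row = "idx \<Rightarrow> (idx \<times> idx) mpol"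

text \<open>Right multiplication of a row by the infinite matrix \<open>X\<close> of
  \<open>x(m)\<close>, whose entry in row \<open>(a + m, i)\<close> and column \<open>(a, j)\<close>
  is \<open>x$i$j\<close>.\<close>

definition rowact :: "complex^3^3 \<Rightarrow> int \<Rightarrow> row \<Rightarrow> row" where
  "rowact x m r = (\<lambda>T. \<Sum>i\<in>UNIV. r (fst T + m, i) * Cst (x$i$(snd T)))"

definition Erow :: "idx \<Rightarrow> row" where
  "Erow P = (\<lambda>S. if fst S < 0 then if S = P then 1 else 0 else - Var (P, S))"

definition neg :: "int \<Rightarrow> idx set" where
  "neg N = {-N..<0} \<times> UNIV"

text \<open>Multiplication of a row by the block column \<open>J\<close>, meant for \<open>Q\<close>
  of nonnegative degree; the window is harmless once the row vanishes below it.\<close>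

definition pair :: "int \<Rightarrow> row \<Rightarrow> row" where
  "pair N r = (\<lambda>Q. r Q + (\<Sum>T\<in>neg N. r T * Var (T, Q)))"

definition Vf :: "complex^3^3 \<Rightarrow> int \<Rightarrow> idx \<Rightarrow> row" where
  "Vf x m P = pair (\<bar>fst P\<bar> + \<bar>m\<bar>) (rowact x m (Erow P))"

definition nonneg_part :: "row \<Rightarrow> row" where
  "nonneg_part r = (\<lambda>S. if fst S < 0 then 0 else r S)"

definition Dv :: "complex^3^3 \<Rightarrow> int \<Rightarrow> (idx \<times> idx) mpol \<Rightarrow> (idx \<times> idx) mpol" where
  "Dv x m = der (\<lambda>(P, Q). if fst P < 0 \<and> fst Q \<ge> 0 then Vf x m P Q else 0)"

lemma finite_neg [simp]: "finite (neg N)"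
  by (simp add: neg_def)

lemma mem_neg: "T \<in> neg N \<longleftrightarrow> - N \<le> fst T \<and> fst T < 0"
  by (cases T) (simp add: neg_def)

lemma neg_mono: "N \<le> N' \<Longrightarrow> neg N \<subseteq> neg N'"
  by (auto simp: mem_neg)

lemma pair_superset:
  assumes "N \<le> N'" "\<And>T. fst T < - N \<Longrightarrow> r T = 0"
  shows "pair N' r = pair N r"
proof
  fix Q
  have "(\<Sum>T\<in>neg N'. r T * Var (T, Q)) = (\<Sum>T\<in>neg N. r T * Var (T, Q))"
    using neg_mono[OF assms(1)] assms(2)
    by (intro sum.mono_neutral_right) (auto simp: mem_neg not_le)
  then show "pair N' r Q = pair N r Q"
    by (simp add: pair_def)
qed

lemma rowact_Erow_eq_0: "fst T < - (\<bar>fst P\<bar> + \<bar>m\<bar>) \<Longrightarrow> rowact x m (Erow P) T = 0"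
  by (auto simp: rowact_def Erow_def intro!: sum.neutral)

lemma Vf_eq_pair: "\<bar>fst P\<bar> + \<bar>m\<bar> \<le> N \<Longrightarrow> Vf x m P = pair N (rowact x m (Erow P))"
  unfolding Vf_def by (rule pair_superset[symmetric]) (simp_all add: rowact_Erow_eq_0)

lemma rowact_rowact: "rowact y m' (rowact x m r) = rowact (x ** y) (m + m') r"
proof
  fix T
  have "rowact y m' (rowact x m r) T =
      (\<Sum>j\<in>UNIV. \<Sum>i\<in>UNIV. r (fst T + m' + m, i) * (Cst (x$i$j) * Cst (y$j$(snd T))))"
    by (simp add: rowact_def sum_distrib_right mult.assoc)
  also have "\<dots> = (\<Sum>i\<in>UNIV. \<Sum>j\<in>UNIV. r (fst T + m' + m, i) * (Cst (x$i$j) * Cst (y$j$(snd T))))"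
    by (rule sum.swap)
  also have "\<dots> = rowact (x ** y) (m + m') r T"
    by (simp add: rowact_def matrix_matrix_mult_def Cst_sum Cst_mult sum_distrib_left add_ac)
  finally show "rowact y m' (rowact x m r) T = rowact (x ** y) (m + m') r T" .
qed

lemma rowact_diff_mat: "rowact (x - y) m r T = rowact x m r T - rowact y m r T"
  by (simp add: rowact_def Cst_diff algebra_simps sum_subtractf)

lemma rowact_diff: "rowact x m (\<lambda>S. r S - s S) T = rowact x m r T - rowact x m s T"
  by (simp add: rowact_def algebra_simps sum_subtractf)

lemma rowact_sum: "rowact x m (\<lambda>S. \<Sum>i\<in>A. c i * s i S) T = (\<Sum>i\<in>A. c i * rowact x m (s i) T)"
proof -
  have "rowact x m (\<lambda>S. \<Sum>i\<in>A. c i * s i S) T =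
      (\<Sum>j\<in>UNIV. \<Sum>i\<in>A. c i * (s i (fst T + m, j) * Cst (x$j$(snd T))))"
    by (simp add: rowact_def sum_distrib_right mult.assoc)
  also have "\<dots> = (\<Sum>i\<in>A. \<Sum>j\<in>UNIV. c i * (s i (fst T + m, j) * Cst (x$j$(snd T))))"
    by (rule sum.swap)
  finally show ?thesis
    by (simp add: rowact_def sum_distrib_left)
qed

lemma pair_diff: "pair N (\<lambda>S. r S - s S) Q = pair N r Q - pair N s Q"
  by (simp add: pair_def algebra_simps sum_subtractf)

lemma pair_sum: "pair N (\<lambda>S. \<Sum>i\<in>A. c i * s i S) Q = (\<Sum>i\<in>A. c i * pair N (s i) Q)"
proof -
  have "(\<Sum>T\<in>neg N. (\<Sum>i\<in>A. c i * s i T) * Var (T, Q)) =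
      (\<Sum>T\<in>neg N. \<Sum>i\<in>A. c i * (s i T * Var (T, Q)))"
    by (simp add: sum_distrib_right mult.assoc)
  also have "\<dots> = (\<Sum>i\<in>A. \<Sum>T\<in>neg N. c i * (s i T * Var (T, Q)))"
    by (rule sum.swap)
  finally show ?thesis
    by (simp add: pair_def distrib_left sum.distrib sum_distrib_left)
qed

text \<open>With \<open>P\<^sub>\<plusminus>\<close> the projections to the two blocks, \<open>1 = P\<^sub>- E + J P\<^sub>+\<close>; this is that identity
  multiplied from the left by a row of \<open>E X\<close>.\<close>

lemma nonneg_part_Vf:
  assumes "\<bar>fst P\<bar> + \<bar>m\<bar> \<le> N"
  shows "nonneg_part (Vf x m P) S =
    rowact x m (Erow P) S - (\<Sum>T\<in>neg N. rowact x m (Erow P) T * Erow T S)"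
proof (cases "fst S < 0")
  case True
  have "(\<Sum>T\<in>neg N. rowact x m (Erow P) T * Erow T S) =
      (\<Sum>T\<in>neg N. if S = T then rowact x m (Erow P) T else 0)"
    using True by (intro sum.cong) (auto simp: Erow_def)
  also have "\<dots> = rowact x m (Erow P) S"
    using True assms by (auto simp: mem_neg intro!: rowact_Erow_eq_0)
  finally show ?thesis
    using True by (simp add: nonneg_part_def)
next
  case False
  then show ?thesis
    by (simp add: nonneg_part_def Vf_eq_pair[OF assms] pair_def Erow_def sum_negf)
qed

text \<open>Only the block \<open>-Z\<close> of \<open>E\<close> varies, and \<open>Vf\<close> is
  the velocity of \<open>Z\<close>.\<close>

lemma Dv_Erow: "fst P < 0 \<Longrightarrow> Dv y m' (Erow P S) = - nonneg_part (Vf y m' P) S"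
  by (auto simp: Dv_def Erow_def nonneg_part_def der_minus)

lemma Dv_rowact_Erow:
  "fst P < 0 \<Longrightarrow> Dv y m' (rowact x m (Erow P) T) = - rowact x m (nonneg_part (Vf y m' P)) T"
  using Dv_Erow[of P y m'] by (simp add: rowact_def Dv_def der_sum der_mult sum_negf)

text \<open>The product rule for \<open>E X J\<close>. Along \<open>Y\<close>,
  \<open>nonneg_part_Vf\<close> gives \<open>dE = E Y P\<^sub>- E - E Y\<close>, while the upper
  block of \<open>J\<close> varies by \<open>E Y J\<close>. The two terms containing
  \<open>P\<^sub>-\<close> together are symmetric in \<open>X\<close> and \<open>Y\<close>.\<close>

lemma Dv_Vf:
  assumes "fst P < 0" "fst Q \<ge> 0" "\<bar>fst P\<bar> + \<bar>m\<bar> + \<bar>m'\<bar> \<le> N" "N + \<bar>m\<bar> + \<bar>m'\<bar> \<le> N'"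
  shows "Dv y m' (Vf x m P Q) = pair N' (\<lambda>S.
      (\<Sum>T\<in>neg N. rowact y m' (Erow P) T * rowact x m (Erow T) S)
      + (\<Sum>T\<in>neg N. rowact x m (Erow P) T * rowact y m' (Erow T) S)
      - rowact x m (rowact y m' (Erow P)) S) Q"
proof -
  let ?R = "rowact x m (nonneg_part (Vf y m' P))"
  have R0: "?R T = 0" if "fst T < - N" for T
    using that assms by (auto simp: rowact_def nonneg_part_def intro!: sum.neutral)
  have "Dv y m' (Vf x m P Q) = Dv y m' (pair N (rowact x m (Erow P)) Q)"
    by (subst Vf_eq_pair[of P m N]) (use assms in auto)
  also have "\<dots> = - ?R Q + (\<Sum>T\<in>neg N. - ?R T * Var (T, Q) + rowact x m (Erow P) T * Vf y m' T Q)"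
  proof -
    have "Dv y m' (pair N (rowact x m (Erow P)) Q) = Dv y m' (rowact x m (Erow P) Q) +
        (\<Sum>T\<in>neg N. Dv y m' (rowact x m (Erow P) T) * Var (T, Q) +
            rowact x m (Erow P) T * Dv y m' (Var (T, Q)))"
      by (simp add: pair_def Dv_def der_add der_sum der_mult)
    also have "\<dots> = - ?R Q + (\<Sum>T\<in>neg N. - ?R T * Var (T, Q) + rowact x m (Erow P) T * Vf y m' T Q)"
      unfolding Dv_rowact_Erow[OF assms(1)]
      by (intro arg_cong2[of _ _ _ _ "(+)"] sum.cong refl) (use assms in \<open>auto simp: Dv_def mem_neg\<close>)
    finally show ?thesis .
  qed
  also have "\<dots> = - pair N ?R Q + (\<Sum>T\<in>neg N. rowact x m (Erow P) T * Vf y m' T Q)"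
    by (simp add: pair_def sum.distrib sum_negf sum_subtractf)
  also have "pair N ?R = pair N' ?R"
    by (rule pair_superset[symmetric]) (use assms R0 in auto)
  also have "(\<Sum>T\<in>neg N. rowact x m (Erow P) T * Vf y m' T Q) =
      (\<Sum>T\<in>neg N. rowact x m (Erow P) T * pair N' (rowact y m' (Erow T)) Q)"
    by (intro sum.cong refl, subst Vf_eq_pair[of _ m' N']) (use assms in \<open>auto simp: mem_neg\<close>)
  also have "\<dots> = pair N' (\<lambda>S. \<Sum>T\<in>neg N. rowact x m (Erow P) T * rowact y m' (Erow T) S) Q"
    by (rule pair_sum[symmetric])
  also have "?R = (\<lambda>S. rowact x m (rowact y m' (Erow P)) S -
      (\<Sum>T\<in>neg N. rowact y m' (Erow P) T * rowact x m (Erow T) S))"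
  proof
    fix S
    have "nonneg_part (Vf y m' P) =
        (\<lambda>S. rowact y m' (Erow P) S - (\<Sum>T\<in>neg N. rowact y m' (Erow P) T * Erow T S))"
      by (rule ext, rule nonneg_part_Vf) (use assms in auto)
    then show "?R S = rowact x m (rowact y m' (Erow P)) S -
      (\<Sum>T\<in>neg N. rowact y m' (Erow P) T * rowact x m (Erow T) S)"
      by (simp add: rowact_diff rowact_sum)
  qed
  finally show ?thesis
    by (simp add: pair_def algebra_simps sum.distrib sum_subtractf)
qed

text \<open>The symmetric terms of \<open>Dv_Vf\<close> cancel and \<open>E (X Y - Y X) J\<close>
  remains. The order of composition is reversed: this is an anti-representation.\<close>

lemma Dv_commutator: "Dv y m' (Dv x m p) - Dv x m (Dv y m' p) = Dv (lbr x y) (m + m') p"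
  unfolding Dv_def
proof (rule der_commutator, clarify, fold Dv_def)
  fix a i b j
  let ?P = "(a, i) :: idx" and ?Q = "(b, j) :: idx"
  show "Dv y m' (if fst ?P < 0 \<and> 0 \<le> fst ?Q then Vf x m ?P ?Q else 0) -
      Dv x m (if fst ?P < 0 \<and> 0 \<le> fst ?Q then Vf y m' ?P ?Q else 0) =
      (if fst ?P < 0 \<and> 0 \<le> fst ?Q then Vf (lbr x y) (m + m') ?P ?Q else 0)"
  proof (cases "a < 0 \<and> b \<ge> 0")
    case False
    then show ?thesis by (auto simp: Dv_def)
  next
    case True
    define N where "N = \<bar>a\<bar> + \<bar>m\<bar> + \<bar>m'\<bar>"
    define N' where "N' = N + \<bar>m\<bar> + \<bar>m'\<bar>"
    have "Dv y m' (Vf x m ?P ?Q) - Dv x m (Vf y m' ?P ?Q) =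
        pair N' (\<lambda>S. rowact y m' (rowact x m (Erow ?P)) S - rowact x m (rowact y m' (Erow ?P)) S) ?Q"
      using True
      by (subst (1 2) Dv_Vf[where N = N and N' = N'])
         (auto simp: N_def N'_def pair_diff[symmetric] algebra_simps)
    also have "\<dots> = pair N' (rowact (lbr x y) (m + m') (Erow ?P)) ?Q"
      by (rule arg_cong[of _ _ "\<lambda>r. pair N' r ?Q"])
         (simp add: fun_eq_iff rowact_rowact lbr_def rowact_diff_mat add.commute)
    also have "\<dots> = Vf (lbr x y) (m + m') ?P ?Q"
      by (subst Vf_eq_pair[of _ _ N']) (auto simp: N_def N'_def)
    finally show ?thesis
      using True by simp
  qed
qed

section \<open>The zeroth order term and its cocycle\<close>

definition lin :: "complex^3^3 \<Rightarrow> int \<Rightarrow> (idx \<times> idx) mpol" where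
  "lin x m = (\<Sum>T\<in>neg \<bar>m\<bar>. rowact x m (nonneg_part (\<lambda>S. Var (T, S))) T)"

lemma rowact_nonneg_part_eq_0: "fst T + m < 0 \<Longrightarrow> rowact x m (nonneg_part r) T = 0"
  by (simp add: rowact_def nonneg_part_def)

lemma lin_superset:
  assumes "\<bar>m\<bar> \<le> N"
  shows "lin x m = (\<Sum>T\<in>neg N. rowact x m (nonneg_part (\<lambda>S. Var (T, S))) T)"
  unfolding lin_def
  using neg_mono[OF assms]
  by (intro sum.mono_neutral_left) (auto simp: mem_neg intro!: rowact_nonneg_part_eq_0)

text \<open>The identity block of \<open>E\<close> contributes \<open>trace x = 0\<close> in each
  degree if \<open>m = 0\<close> and nothing otherwise; the block \<open>-Z\<close> contributes
  minus the trace of \<open>X Z\<close>.\<close>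

lemma sum_rowact_Erow:
  assumes "\<bar>m\<bar> \<le> N" "trace x = 0"
  shows "(\<Sum>T\<in>neg N. rowact x m (Erow T) T) = - lin x m"
proof -
  have 1: "rowact x m (Erow T) T = - rowact x m (nonneg_part (\<lambda>S. Var (T, S))) T +
      (if m = 0 then Cst (x$(snd T)$(snd T)) else 0)" if "T \<in> neg N" for T
  proof (cases "fst T + m < 0")
    case True
    then have "rowact x m (Erow T) T =
        (\<Sum>i\<in>UNIV. if i = snd T then if m = 0 then Cst (x$i$(snd T)) else 0 else 0)"
      unfolding rowact_def by (intro sum.cong) (auto simp: Erow_def prod_eq_iff)
    with True show ?thesis
      by (simp add: rowact_nonneg_part_eq_0)
  next
    case False
    with that have "m \<noteq> 0" by (auto simp: mem_neg)
    with False show ?thesis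
      by (simp add: rowact_def Erow_def nonneg_part_def sum_negf)
  qed
  have 2: "(\<Sum>T\<in>neg N. Cst (x$(snd T)$(snd T))) = (0 :: (idx \<times> idx) mpol)"
  proof -
    have "(\<Sum>T\<in>neg N. Cst (x$(snd T)$(snd T)) :: (idx \<times> idx) mpol) =
        (\<Sum>a\<in>{-N..<0}. \<Sum>i\<in>UNIV. Cst (x$i$i))"
      unfolding neg_def sum.cartesian_product' by simp
    also have "\<dots> = (\<Sum>a\<in>{-N..<0}. Cst (trace x))"
      by (simp add: trace_def Cst_sum)
    finally show ?thesis
      by (simp add: assms)
  qed
  have "(\<Sum>T\<in>neg N. rowact x m (Erow T) T) =
      (\<Sum>T\<in>neg N. - rowact x m (nonneg_part (\<lambda>S. Var (T, S))) T +
      (if m = 0 then Cst (x$(snd T)$(snd T)) else 0))"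
    by (intro sum.cong 1 refl)
  also have "\<dots> = - lin x m"
    unfolding sum.distrib sum_negf lin_superset[OF assms(1)] using 2 by (cases "m = 0") simp_all
  finally show ?thesis .
qed

text \<open>Summed over the whole window \<open>neg N\<close> in both indices this product would be symmetric in
  \<open>x(m)\<close> and \<open>y(m')\<close>; the terms that leave the window produce the central term.\<close>

lemma boundary_sum:
  assumes "\<bar>m\<bar> + \<bar>m'\<bar> \<le> N"
  shows "(\<Sum>T\<in>neg N. \<Sum>U\<in>neg (N + \<bar>m\<bar> + \<bar>m'\<bar>) - neg N.
      rowact y m' (Erow T) U * rowact x m (Erow U) T) =
    Cst (if m + m' = 0 then of_int (max 0 m') * trace (x ** y) else 0)"
proof -
  let ?N' = "N + \<bar>m\<bar> + \<bar>m'\<bar>"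
  \<comment> \<open>When the shifted degree is negative, only the identity block of
    \<open>Erow\<close> is met.\<close>
  have 1: "rowact z p (Erow P) S = (if fst P = fst S + p then Cst (z$(snd P)$(snd S)) else 0)"
    if "fst S + p < 0" for z p P S
  proof -
    have "rowact z p (Erow P) S =
        (\<Sum>i\<in>UNIV. if i = snd P then if fst P = fst S + p then Cst (z$i$(snd S)) else 0 else 0)"
      using that unfolding rowact_def by (intro sum.cong) (auto simp: Erow_def prod_eq_iff)
    then show ?thesis by simp
  qed
  \<comment> \<open>Both factors reduce to matrix entries, and the two degree shifts have to
    cancel.\<close>
  have 2: "rowact y m' (Erow T) U * rowact x m (Erow U) T =
      (if fst T = fst U + m' \<and> m + m' = 0 then Cst (y$(snd T)$(snd U) * x$(snd U)$(snd T)) else 0)"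
    if "T \<in> neg N" "U \<in> neg ?N' - neg N" for T U
  proof -
    have "fst U + m' < 0" using that assms by (auto simp: mem_neg)
    note T = 1[OF this, of y T]
    show ?thesis
    proof (cases "fst T = fst U + m'")
      case True
      have "fst T + m < 0"
        using that True assms by (auto simp: mem_neg)
      from 1[OF this, of x U] T True show ?thesis
        by (auto simp: Cst_mult)
    qed (simp add: T)
  qed
  have "(\<Sum>T\<in>neg N. \<Sum>U\<in>neg ?N' - neg N. rowact y m' (Erow T) U * rowact x m (Erow U) T) =
      (\<Sum>T\<in>neg N. \<Sum>U\<in>neg ?N' - neg N.
        (if fst T = fst U + m' \<and> m + m' = 0 then Cst (y$(snd T)$(snd U) * x$(snd U)$(snd T)) else 0))"
    by (intro sum.cong 2 refl)
  also have "\<dots> = Cst (if m + m' = 0 then of_int (max 0 m') * trace (x ** y) else 0)"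
  proof (cases "m + m' = 0")
    case True
    have diff: "neg ?N' - neg N = {-?N'..<-N} \<times> UNIV"
      using assms by (auto simp: neg_def)
    have tr: "(\<Sum>i\<in>UNIV. \<Sum>j\<in>UNIV. y$i$j * x$j$i) = trace (x ** y)"
      by (subst sum.swap) (simp add: trace_def matrix_matrix_mult_def mult.commute)
    \<comment> \<open>For a given degree \<open>a\<close> the only candidate is
      \<open>b = a - m'\<close>. It lies below the window exactly if \<open>a < m' - N\<close>,
      which happens for \<open>max 0 m'\<close> values of \<open>a\<close>.\<close>
    have inner: "(\<Sum>b\<in>{-?N'..<-N}. if a = b + m' then 1 else 0 :: complex) =
        (if a < m' - N then 1 else 0)" if "a \<in> {-N..<0}" for a
    proof -
      have "(\<Sum>b\<in>{-?N'..<-N}. if a = b + m' then 1 else 0 :: complex) =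
          (\<Sum>b\<in>{-?N'..<-N}. if b = a - m' then 1 else 0)"
        by (intro sum.cong) auto
      also have "\<dots> = (if a - m' \<in> {-?N'..<-N} then 1 else 0)"
        by simp
      also have "a - m' \<in> {-?N'..<-N} \<longleftrightarrow> a < m' - N"
        using that by auto
      finally show ?thesis .
    qed
    have "(\<Sum>T\<in>neg N. \<Sum>U\<in>neg ?N' - neg N.
        (if fst T = fst U + m' \<and> m + m' = 0 then Cst (y$(snd T)$(snd U) * x$(snd U)$(snd T)) else 0)) =
        Cst (\<Sum>a\<in>{-N..<0}. \<Sum>i\<in>UNIV. \<Sum>b\<in>{-?N'..<-N}. \<Sum>j\<in>UNIV.
          (if a = b + m' then 1 else 0) * (y$i$j * x$j$i))"
      unfolding diff unfolding neg_def sum.cartesian_product' Cst_sum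
      using True by (intro sum.cong) auto
    also have "(\<Sum>a\<in>{-N..<0}. \<Sum>i\<in>UNIV. \<Sum>b\<in>{-?N'..<-N}. \<Sum>j\<in>UNIV.
          (if a = b + m' then 1 else 0) * (y$i$j * x$j$i)) =
        (\<Sum>a\<in>{-N..<0}. \<Sum>b\<in>{-?N'..<-N}. (if a = b + m' then 1 else 0) * trace (x ** y))"
      unfolding tr[symmetric] sum_distrib_left
      by (rule sum.cong[OF refl], rule sum.swap)
    also have "\<dots> = (\<Sum>a\<in>{-N..<0}. if a < m' - N then 1 else 0) * trace (x ** y)"
      unfolding sum_distrib_right[symmetric]
      by (intro arg_cong2[of _ _ _ _ "(*)"] sum.cong inner refl)
    also have "(\<Sum>a\<in>{-N..<0}. if a < m' - N then 1 else 0 :: complex) = of_int (max 0 m')"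
    proof -
      have "(\<Sum>a\<in>{-N..<0}. if a < m' - N then 1 else 0 :: complex) = (\<Sum>a\<in>{-N..<m'-N}. 1)"
        using assms by (intro sum.mono_neutral_cong_right) auto
      then show ?thesis by (simp add: max_def)
    qed
    finally show ?thesis using True by simp
  qed simp
  finally show ?thesis .
qed

text \<open>Differentiating \<open>Z\<close> gives the nonnegative part of \<open>Vf\<close>, which
  \<open>nonneg_part_Vf\<close> expands. The inner sum needs a larger window than the trace; the
  excess is \<open>boundary_sum\<close>.\<close>

lemma Dv_lin:
  assumes "\<bar>m\<bar> + \<bar>m'\<bar> \<le> N"
  shows "Dv y m' (lin x m) = (\<Sum>T\<in>neg N. rowact (y ** x) (m + m') (Erow T) T)
    - (\<Sum>T\<in>neg N. \<Sum>U\<in>neg N. rowact y m' (Erow T) U * rowact x m (Erow U) T)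
    - Cst (if m + m' = 0 then of_int (max 0 m') * trace (x ** y) else 0)"
proof -
  let ?N' = "N + \<bar>m\<bar> + \<bar>m'\<bar>"
  have "Dv y m' (lin x m) = (\<Sum>T\<in>neg N. Dv y m' (rowact x m (nonneg_part (\<lambda>S. Var (T, S))) T))"
    using assms by (subst lin_superset[of m N]) (simp_all add: Dv_def der_sum)
  also have "\<dots> = (\<Sum>T\<in>neg N. rowact x m (nonneg_part (Vf y m' T)) T)"
  proof (rule sum.cong[OF refl])
    fix T assume T: "T \<in> neg N"
    have "Dv y m' (nonneg_part (\<lambda>S. Var (T, S)) S) = nonneg_part (Vf y m' T) S" for S
      using T by (simp add: nonneg_part_def Dv_def mem_neg)
    then show "Dv y m' (rowact x m (nonneg_part (\<lambda>S. Var (T, S))) T) = rowact x m (nonneg_part (Vf y m' T)) T"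
      by (simp add: rowact_def Dv_def der_sum der_mult)
  qed
  also have "\<dots> = (\<Sum>T\<in>neg N. rowact (y ** x) (m + m') (Erow T) T -
      (\<Sum>U\<in>neg ?N'. rowact y m' (Erow T) U * rowact x m (Erow U) T))"
  proof (rule sum.cong[OF refl])
    fix T assume T: "T \<in> neg N"
    have "nonneg_part (Vf y m' T) =
        (\<lambda>S. rowact y m' (Erow T) S - (\<Sum>U\<in>neg ?N'. rowact y m' (Erow T) U * Erow U S))"
      by (rule ext, rule nonneg_part_Vf) (use T in \<open>auto simp: mem_neg\<close>)
    then show "rowact x m (nonneg_part (Vf y m' T)) T = rowact (y ** x) (m + m') (Erow T) T -
        (\<Sum>U\<in>neg ?N'. rowact y m' (Erow T) U * rowact x m (Erow U) T)"
      by (simp add: rowact_diff rowact_sum rowact_rowact add.commute)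
  qed
  also have "\<dots> = (\<Sum>T\<in>neg N. rowact (y ** x) (m + m') (Erow T) T) -
      ((\<Sum>T\<in>neg N. \<Sum>U\<in>neg N. rowact y m' (Erow T) U * rowact x m (Erow U) T) +
       (\<Sum>T\<in>neg N. \<Sum>U\<in>neg ?N' - neg N. rowact y m' (Erow T) U * rowact x m (Erow U) T))"
    unfolding sum.distrib[symmetric] sum_subtractf
    by (intro arg_cong2[of _ _ _ _ "(-)"] refl sum.cong)
       (use neg_mono[of N ?N'] sum.subset_diff[of "neg N" "neg ?N'"] in \<open>simp add: add.commute\<close>)
  finally show ?thesis
    unfolding boundary_sum[OF assms] by simp
qed

lemma trace_mult_commute: "trace (x ** y) = trace (y ** x)" for x y :: "complex^3^3"
  unfolding trace_def matrix_matrix_mult_def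
  by (simp add: mult.commute) (subst sum.swap, simp)

lemma lbr_in_sl3: "lbr x y \<in> sl3"
  using trace_mult_commute[of x y] by (simp add: sl3_def lbr_def trace_def sum_subtractf)

text \<open>The double sums over the common window are symmetric and cancel. The single sums combine
  to the trace for the bracket, and for \<open>m' = - m\<close> the boundary terms differ by the
  factor \<open>max 0 m - max 0 (- m) = m\<close>.\<close>

lemma lin_cocycle:
  "Dv y m' (lin x m) - Dv x m (lin y m') =
    lin (lbr x y) (m + m') + Cst (if m + m' = 0 then of_int m * trace (x ** y) else 0)"
proof -
  define N where "N = \<bar>m\<bar> + \<bar>m'\<bar>"
  have sym: "(\<Sum>T\<in>neg N. \<Sum>U\<in>neg N. rowact y m' (Erow T) U * rowact x m (Erow U) T) =
      (\<Sum>T\<in>neg N. \<Sum>U\<in>neg N. rowact x m (Erow T) U * rowact y m' (Erow U) T)"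
    by (subst sum.swap) (simp add: mult.commute)
  have "Dv y m' (lin x m) - Dv x m (lin y m') =
      (\<Sum>T\<in>neg N. rowact (y ** x) (m + m') (Erow T) T) - (\<Sum>T\<in>neg N. rowact (x ** y) (m + m') (Erow T) T)
      + (Cst (if m + m' = 0 then of_int (max 0 m) * trace (x ** y) else 0)
         - Cst (if m + m' = 0 then of_int (max 0 m') * trace (x ** y) else 0))"
    using sym by (subst (1 2) Dv_lin[of _ _ N]) (auto simp: N_def add.commute trace_mult_commute[of y x])
  also have "Cst (if m + m' = 0 then of_int (max 0 m) * trace (x ** y) else 0)
         - Cst (if m + m' = 0 then of_int (max 0 m') * trace (x ** y) else 0) =
      Cst (if m + m' = 0 then of_int m * trace (x ** y) else 0)"
  proof (cases "m + m' = 0")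
    case True
    then have "m' = - m" by simp
    then have "of_int (max 0 m) - of_int (max 0 m') = (of_int m :: complex)"
      by (simp add: max_def)
    with True show ?thesis
      by (simp add: Cst_diff[symmetric] left_diff_distrib[symmetric])
  qed simp
  also have "(\<Sum>T\<in>neg N. rowact (y ** x) (m + m') (Erow T) T) -
      (\<Sum>T\<in>neg N. rowact (x ** y) (m + m') (Erow T) T) =
      - (\<Sum>T\<in>neg N. rowact (lbr x y) (m + m') (Erow T) T)"
    by (simp add: lbr_def rowact_diff_mat sum_subtractf)
  also have "\<dots> = lin (lbr x y) (m + m')"
    using lbr_in_sl3[of x y] by (subst sum_rowact_Erow) (auto simp: N_def sl3_def)
  finally show ?thesis .
qed

section \<open>The anti-representation of level \<open>k\<close> and the evaluation of words\<close>

definition Lop :: "complex \<Rightarrow> complex^3^3 \<Rightarrow> int \<Rightarrow> (idx \<times> idx) mpol \<Rightarrow> (idx \<times> idx) mpol" where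
  "Lop k x m p = Dv x m p + Cst k * lin x m * p"

text \<open>Products of two \<open>lin\<close> cancel in the commutator of these first order
  operators. Their derivatives remain, so \<open>lin_cocycle\<close> multiplied by \<open>k\<close>
  supplies the central term.\<close>

lemma Lop_commutator:
  "Lop k y m' (Lop k x m p) - Lop k x m (Lop k y m' p) =
    Lop k (lbr x y) (m + m') p + Cst (if m + m' = 0 then of_int m * trace (x ** y) else 0) * (Cst k * p)"
proof -
  have "Lop k y m' (Lop k x m p) - Lop k x m (Lop k y m' p) =
      (Dv y m' (Dv x m p) - Dv x m (Dv y m' p)) + Cst k * (Dv y m' (lin x m) - Dv x m (lin y m')) * p"
    by (simp add: Lop_def Dv_def der_add der_mult algebra_simps)
  then show ?thesis
    unfolding Dv_commutator lin_cocycle by (simp add: Lop_def algebra_simps)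
qed

text \<open>Words are applied from left to right because \<open>Lop\<close> is an anti-representation.\<close>

definition gop :: "complex \<Rightarrow> gen \<Rightarrow> (idx \<times> idx) mpol \<Rightarrow> (idx \<times> idx) mpol" where
  "gop k g p = (case g of G x m \<Rightarrow> if x \<in> sl3 then Lop k x m p else 0 | Cc \<Rightarrow> Cst k * p)"

definition wop :: "complex \<Rightarrow> gen list \<Rightarrow> (idx \<times> idx) mpol \<Rightarrow> (idx \<times> idx) mpol" where
  "wop k = fold (gop k)"

definition ev :: "complex \<Rightarrow> elt \<Rightarrow> (idx \<times> idx) mpol \<Rightarrow> (idx \<times> idx) mpol" where
  "ev k a p = (\<Sum>w | a w \<noteq> 0. Cst (a w) * wop k w p)"

lemma Lop_add: "Lop k x m (p + q) = Lop k x m p + Lop k x m q"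
  by (simp add: Lop_def Dv_def der_add algebra_simps)

lemma Lop_Cst_mult: "Lop k x m (Cst c * p) = Cst c * Lop k x m p"
  unfolding Lop_def Dv_def der_Cst_mult by (simp only: algebra_simps)

lemma gop_add: "gop k g (p + q) = gop k g p + gop k g q"
  by (cases g) (simp_all add: gop_def Lop_add algebra_simps)

lemma gop_Cst_mult: "gop k g (Cst c * p) = Cst c * gop k g p"
  by (cases g) (simp_all add: gop_def Lop_Cst_mult mult.left_commute)

lemma wop_add: "wop k w (p + q) = wop k w p + wop k w q"
  unfolding wop_def by (induction w arbitrary: p q) (simp_all add: gop_add)

lemma wop_Cst_mult: "wop k w (Cst c * p) = Cst c * wop k w p"
  unfolding wop_def by (induction w arbitrary: p) (simp_all add: gop_Cst_mult)

lemma ev_superset: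
  assumes "finite S" "{w. a w \<noteq> 0} \<subseteq> S"
  shows "ev k a p = (\<Sum>w\<in>S. Cst (a w) * wop k w p)"
  unfolding ev_def by (rule sum.mono_neutral_left) (use assms in auto)

lemma ev_fadd:
  assumes "fin a" "fin b"
  shows "ev k (fadd a b) p = ev k a p + ev k b p"
proof -
  let ?S = "{w. a w \<noteq> 0} \<union> {w. b w \<noteq> 0}"
  have "ev k (fadd a b) p = (\<Sum>w\<in>?S. Cst (fadd a b w) * wop k w p)"
    by (rule ev_superset) (use assms in \<open>auto simp: fin_def fadd_def\<close>)
  also have "\<dots> = (\<Sum>w\<in>?S. Cst (a w) * wop k w p) + (\<Sum>w\<in>?S. Cst (b w) * wop k w p)"
    by (simp add: fadd_def Cst_add distrib_right sum.distrib)
  also have "\<dots> = ev k a p + ev k b p"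
    using assms by (simp add: ev_superset[of ?S] fin_def)
  finally show ?thesis .
qed

lemma ev_fzero [simp]: "ev k fzero p = 0"
  by (simp add: ev_def fzero_def)

lemma ev_mon [simp]: "ev k (mon w) p = wop k w p"
  by (simp add: ev_def mon_def)

lemma ev_fsmul: "ev k (fsmul c a) p = Cst c * ev k a p"
proof (cases "c = 0")
  case False
  then show ?thesis
    by (simp add: ev_def fsmul_def Cst_mult sum_distrib_left mult.assoc)
qed (simp add: ev_def fsmul_def)

lemma ev_fsub:
  assumes "fin a" "fin b"
  shows "ev k (fsub a b) p = ev k a p - ev k b p"
proof -
  have "fsub a b = fadd a (fsmul (-1) b)"
    by (simp add: fsub_def fadd_def fsmul_def)
  with assms show ?thesis
    by (simp add: ev_fadd ev_fsmul Cst_minus)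
qed

lemma ev_add: "ev k a (p + q) = ev k a p + ev k a q"
  by (simp add: ev_def wop_add algebra_simps sum.distrib)

lemma ev_Cst_mult: "ev k a (Cst c * p) = Cst c * ev k a p"
  by (simp add: ev_def wop_Cst_mult sum_distrib_left mult.left_commute)

lemma ev_0 [simp]: "ev k a 0 = 0"
  using ev_Cst_mult[of k a 0 0] by simp

text \<open>The first letters of a word act first, so evaluation reverses products; this is the
  order in which \<open>Lop_commutator\<close> is stated.\<close>

lemma ev_fmul:
  assumes "fin a" "fin b"
  shows "ev k (fmul a b) p = ev k b (ev k a p)"
  using assms(1)
proof (induction a rule: fin_induct)
  case (add c u a)
  have "ev k (fmul (mon u) b) p = ev k b (wop k u p)"
    using assms(2)
  proof (induction b rule: fin_induct)
    case (add d v b)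
    have "wop k (u @ v) p = wop k v (wop k u p)"
      by (simp add: wop_def)
    with add show ?case
      by (simp add: fmul_fadd_right fmul_fsmul_right fmul_mon ev_fadd ev_fsmul)
  qed simp
  with add assms(2) show ?case
    by (simp add: fmul_fadd_left fmul_fsmul_left ev_fadd ev_fsmul ev_add ev_Cst_mult)
qed simp

lemma ev_gm: "ev k (gm x m) p = (if x \<in> sl3 then Lop k x m p else 0)"
  by (simp add: gm_def wop_def gop_def)

lemma ev_cc: "ev k cc p = Cst k * p"
  by (simp add: cc_def wop_def gop_def)

lemma rowact_lincomb:
  "rowact (msc a x + msc b y) m r T = Cst a * rowact x m r T + Cst b * rowact y m r T"
  by (simp add: rowact_def msc_def Cst_add Cst_mult algebra_simps sum.distrib sum_distrib_left)

lemma Lop_lincomb: "Lop k (msc a x + msc b y) m p = Cst a * Lop k x m p + Cst b * Lop k y m p"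
proof -
  have Vf: "Vf (msc a x + msc b y) m P Q = Cst a * Vf x m P Q + Cst b * Vf y m P Q" for P Q
    by (simp add: Vf_def pair_def rowact_lincomb algebra_simps sum.distrib sum_distrib_left)
  have "Dv (msc a x + msc b y) m p = Cst a * Dv x m p + Cst b * Dv y m p"
  proof (induction p rule: mpol_induct)
    case (Var v)
    then show ?case by (cases v) (simp add: Dv_def Vf)
  qed (simp_all add: Dv_def der_add der_mult algebra_simps)
  moreover have "lin (msc a x + msc b y) m = Cst a * lin x m + Cst b * lin y m"
    by (simp add: lin_def rowact_lincomb sum.distrib sum_distrib_left)
  ultimately show ?thesis
    by (simp add: Lop_def algebra_simps)
qed

lemma sl3_lincomb: "x \<in> sl3 \<Longrightarrow> y \<in> sl3 \<Longrightarrow> msc a x + msc b y \<in> sl3"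
  by (simp add: sl3_def trace_def msc_def sum.distrib sum_distrib_left[symmetric])

lemma ev_rels:
  assumes "r \<in> rels"
  shows "ev k r p = 0"
proof -
  consider a b x y m where "x \<in> sl3" "y \<in> sl3"
      "r = fsub (gm (msc a x + msc b y) m) (fadd (fsmul a (gm x m)) (fsmul b (gm y m)))"
    | x m where "x \<notin> sl3" "r = gm x m"
    | x y m n where "x \<in> sl3" "y \<in> sl3"
      "r = fsub (fsub (fmul (gm x m) (gm y n)) (fmul (gm y n) (gm x m)))
           (fadd (gm (lbr x y) (m + n))
                 (fsmul (if m + n = 0 then of_int m * trace (x ** y) else 0) cc))"
    | x m where "r = fsub (fmul cc (gm x m)) (fmul (gm x m) cc)"
    using assms unfolding rels_def by blast
  then show ?thesis
  proof cases
    case 1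
    then show ?thesis
      by (simp add: ev_fsub ev_fadd ev_fsmul ev_gm sl3_lincomb Lop_lincomb)
  next
    case 2
    then show ?thesis by (simp add: ev_gm)
  next
    case 3
    have "ev k r p = Lop k y n (Lop k x m p) - Lop k x m (Lop k y n p) -
        (Lop k (lbr x y) (m + n) p + Cst (if m + n = 0 then of_int m * trace (x ** y) else 0) * (Cst k * p))"
      unfolding 3(3) using 3(1,2)
      by (simp only: ev_fsub ev_fadd ev_fsmul ev_fmul ev_gm ev_cc lbr_in_sl3 fin_gm fin_cc
          fin_fmul fin_fsub fin_fadd fin_fsmul if_True)
    then show ?thesis by (simp add: Lop_commutator)
  next
    case 4
    then show ?thesis
      by (simp add: ev_fsub ev_fmul ev_gm ev_cc Lop_Cst_mult)
  qed
qed

text \<open>For \<open>m \<ge> 0\<close> the base point \<open>Z = 0\<close> is fixed, so the vector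
  field vanishes at the origin; \<open>lin\<close> has no constant term.\<close>

lemma const_term_Lop_eq_0:
  assumes "m \<ge> 0"
  shows "const_term (Lop k x m p) = 0"
proof -
  have row: "const_term (rowact x m (Erow P) Q) = 0" if "fst Q \<ge> 0" for P Q
    using that assms
    by (simp add: rowact_def Erow_def const_term_sum const_term_mult const_term_minus)
  have "const_term (Dv x m p) = 0"
    unfolding Dv_def
    by (rule const_term_der) (auto simp: Vf_def pair_def const_term_add const_term_sum const_term_mult row)
  moreover have "const_term (lin x m) = 0"
  proof -
    have "const_term (nonneg_part (\<lambda>S. Var (T, S)) S) = 0" for T S
      by (simp add: nonneg_part_def)
    then show ?thesis
      by (simp add: lin_def rowact_def const_term_sum const_term_mult)
  qed
  ultimately show ?thesis
    by (simp add: Lop_def const_term_add const_term_mult)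
qed

text \<open>In a generator \<open>fmul a g\<close> coming from the vacuum conditions,
  \<open>g\<close> acts last, directly before evaluation at the origin.\<close>

lemma const_term_ev_Nid:
  assumes "a \<in> Nid k"
  shows "const_term (ev k a p) = 0"
  using assms
proof induction
  case (rel r a b)
  then show ?case by (simp add: ev_fmul ev_rels fin_rels)
next
  case (ann g a)
  then have "const_term (ev k g q) = 0" for q
    by (auto simp: anns_def ev_gm const_term_Lop_eq_0 ev_fsub ev_cc ev_fsmul wop_def)
  with ann show ?case by (simp add: ev_fmul fin_anns)
next
  case (add a b)
  then show ?case by (simp add: ev_fadd fin_Nid const_term_add)
qed simp

section \<open>Coordinates of the lowest block and nonvanishing\<close>

definition Zvar :: "3 \<Rightarrow> 3 \<Rightarrow> (idx \<times> idx) mpol" where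
  "Zvar i j = Var ((-1, i), (0, j))"

text \<open>The trace meets only columns of negative degree, where \<open>Z\<close> has no entries.
  Hence \<open>Lop k x (-1)\<close> is a derivation.\<close>

lemma lin_minus_1: "lin x (-1) = 0"
  unfolding lin_def by (intro sum.neutral) (auto simp: mem_neg intro!: rowact_nonneg_part_eq_0)

lemma Lop_minus_1_Zvar: "Lop k x (-1) (Zvar i j) = Cst (x$i$j)"
proof -
  \<comment> \<open>In columns of degree at most 0 only the identity block of \<open>Erow\<close> is
    met: the row is constant there, and zero in negative degrees, so that the part involving
    \<open>Z\<close> drops out.\<close>
  have r: "rowact x (-1) (Erow (-1, i)) (a, j) = (if a = 0 then Cst (x$i$j) else 0)" if "a \<le> 0" for a j
  proof -
    have "rowact x (-1) (Erow (-1, i)) (a, j) =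
        (\<Sum>l\<in>UNIV. if l = i then if a = 0 then Cst (x$l$j) else 0 else 0)"
      using that unfolding rowact_def by (intro sum.cong) (auto simp: Erow_def)
    then show ?thesis by simp
  qed
  have "(\<Sum>T\<in>neg 2. rowact x (-1) (Erow (-1, i)) T * Var (T, (0, j))) = 0"
    by (intro sum.neutral) (auto simp: mem_neg r)
  then have "Vf x (-1) (-1, i) (0, j) = Cst (x$i$j)"
    by (simp add: Vf_def pair_def r)
  then show ?thesis
    by (simp add: Lop_def Dv_def Zvar_def lin_minus_1)
qed

lemma Emat_nth: "Emat i j $ a $ b = (if a = i \<and> b = j then 1 else 0)"
  by (simp add: Emat_def)

lemma msc_nth: "msc c x $ a $ b = c * x $ a $ b"
  by (simp add: msc_def)

lemma Emat_in_sl3: "i \<noteq> j \<Longrightarrow> Emat i j \<in> sl3"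
  by (auto simp: sl3_def trace_def Emat_nth intro!: sum.neutral)

lemma msc_in_sl3: "x \<in> sl3 \<Longrightarrow> msc c x \<in> sl3"
  by (simp add: sl3_def trace_def msc_def sum_distrib_left[symmetric])

lemma root_vectors_in_sl3: "e12 \<in> sl3" "e23 \<in> sl3" "e13 \<in> sl3" "f12 \<in> sl3"
  by (simp_all add: e12_def e23_def e13_def f12_def Emat_in_sl3 msc_in_sl3)

lemma lincomb_insert:
  assumes "finite A" "t \<notin> A"
  shows "(\<lambda>w. \<Sum>s\<in>insert t A. c s * mon (u s) w) =
    fadd (fsmul (c t) (mon (u t))) (\<lambda>w. \<Sum>s\<in>A. c s * mon (u s) w)"
  using assms by (simp add: fadd_def fsmul_def)

lemma fin_lincomb: "finite A \<Longrightarrow> fin (\<lambda>w. \<Sum>s\<in>A. c s * mon (u s) w)"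
proof (induction A rule: finite_induct)
  case empty
  then show ?case using fin_fzero by (simp add: fzero_def)
next
  case (insert t A)
  then show ?case unfolding lincomb_insert[OF insert.hyps] by simp
qed

lemma ev_lincomb:
  "finite A \<Longrightarrow> ev k (\<lambda>w. \<Sum>s\<in>A. c s * mon (u s) w) p = (\<Sum>s\<in>A. Cst (c s) * wop k (u s) p)"
proof (induction A rule: finite_induct)
  case empty
  then show ?case using ev_fzero[of k p] by (simp add: fzero_def)
next
  case (insert t A)
  then show ?case
    unfolding lincomb_insert[OF insert.hyps(1,2)] by (simp add: ev_fadd ev_fsmul fin_lincomb)
qed

lemma Lop_minus_1_mult: "Lop k x (-1) (p * q) = Lop k x (-1) p * q + p * Lop k x (-1) q"
  by (simp add: Lop_def Dv_def der_mult lin_minus_1)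

lemma derivation_power:
  assumes "\<And>p q. D (p * q) = D p * q + p * D q" "D (z :: 'v mpol) = Cst c"
  shows "D (z ^ Suc j) = Cst (of_nat (Suc j) * c) * z ^ j"
proof (induction j)
  case (Suc j)
  have "D (z ^ Suc (Suc j)) = Cst c * z ^ Suc j + z * D (z ^ Suc j)"
    using assms by simp
  also have "\<dots> = (Cst c + Cst (of_nat (Suc j) * c)) * z ^ Suc j"
    unfolding Suc by (simp add: algebra_simps del: of_nat_Suc)
  also have "Cst c + Cst (of_nat (Suc j) * c) = Cst (of_nat (Suc (Suc j)) * c)"
    by (simp only: of_nat_Suc[of "Suc j"] distrib_right Cst_add mult_1)
  finally show ?case .
qed (use assms in simp)

lemma wop_replicate_power:
  assumes x: "x \<in> sl3" and z: "Lop k x (-1) z = 1" and q: "Lop k x (-1) q = 0"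
  shows "wop k (replicate j (G x (-1))) (z ^ j * q) = Cst (fact j) * q"
proof (induction j)
  case 0
  then show ?case by (simp add: wop_def)
next
  case (Suc j)
  have "Lop k x (-1) (z ^ Suc j * q) = Cst (of_nat (Suc j)) * (z ^ j * q)"
    using derivation_power[of "Lop k x (-1)" z 1 j, OF Lop_minus_1_mult] z q
    by (simp add: Lop_minus_1_mult[of _ _ "_ ^ _"] mult.assoc del: power_Suc)
  then have "wop k (replicate (Suc j) (G x (-1))) (z ^ Suc j * q) =
      wop k (replicate j (G x (-1))) (Cst (of_nat (Suc j)) * (z ^ j * q))"
    using x by (simp add: wop_def gop_def)
  also have "\<dots> = Cst (fact (Suc j)) * q"
    unfolding wop_Cst_mult Suc by (simp add: Cst_mult)
  finally show ?case .
qed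

lemma wop_0 [simp]: "wop k w 0 = 0"
  using wop_Cst_mult[of k w 0 0] by simp

lemma Lop_minus_1_power_eq_0: "Lop k x (-1) z = 0 \<Longrightarrow> Lop k x (-1) (z ^ j) = 0"
  by (induction j) (use Lop_minus_1_mult[of k x 1 1] in \<open>auto simp: Lop_minus_1_mult\<close>)

lemma v2_notin_Nid: "v2 n \<notin> Nid k"
proof
  assume "v2 n \<in> Nid k"
  \<comment> \<open>The factors are dual to \<open>e23\<close> and \<open>e12\<close>; the
    coordinate \<open>Zvar 0 2\<close>, the only one of the lowest block moved by
    \<open>e13(-1)\<close>, does not occur.\<close>
  define p where "p = Zvar 1 2 ^ (2 * n) * Zvar 0 1 ^ n"
  define u where "u t = replicate t (G e13 (-1)) @ replicate (2*n - t) (G e23 (-1)) @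
           replicate t (G f12 0) @ replicate n (G e12 (-1))" for t
  have e13: "Lop k e13 (-1) p = 0"
    unfolding p_def
    by (simp add: Lop_minus_1_mult Lop_minus_1_power_eq_0 Lop_minus_1_Zvar e13_def msc_nth Emat_nth)
  \<comment> \<open>Such a word starts with \<open>e13(-1)\<close>, which therefore acts first and
    kills \<open>p\<close>.\<close>
  have pos: "wop k (u t) p = 0" if "t > 0" for t
  proof -
    have "wop k (u t) p = wop k (tl (u t)) (gop k (hd (u t)) p)"
      using that by (cases t) (simp_all add: u_def wop_def)
    also have "gop k (hd (u t)) p = 0"
      using that e13 by (cases t) (simp_all add: u_def gop_def)
    finally show ?thesis by simp
  qed
  have zero: "wop k (u 0) p = Cst (fact (2 * n) * fact n)"
  proof -
    have "wop k (u 0) p = wop k (replicate n (G e12 (-1))) (wop k (replicate (2*n) (G e23 (-1))) p)"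
      by (simp add: u_def wop_def)
    also have "wop k (replicate (2*n) (G e23 (-1))) p = Cst (fact (2 * n)) * Zvar 0 1 ^ n"
      unfolding p_def
      by (rule wop_replicate_power)
         (simp_all add: root_vectors_in_sl3 Lop_minus_1_power_eq_0 Lop_minus_1_Zvar Emat_in_sl3 e23_def Emat_nth)
    also have "wop k (replicate n (G e12 (-1))) (Cst (fact (2 * n)) * Zvar 0 1 ^ n) =
        Cst (fact (2 * n)) * wop k (replicate n (G e12 (-1))) (Zvar 0 1 ^ n * 1)"
      by (simp add: wop_Cst_mult)
    also have "wop k (replicate n (G e12 (-1))) (Zvar 0 1 ^ n * 1) = Cst (fact n) * 1"
      by (rule wop_replicate_power)
         (use Lop_minus_1_mult[of k e12 1 1] in \<open>auto simp: Emat_in_sl3 Lop_minus_1_Zvar e12_def Emat_nth\<close>)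
    finally show ?thesis by (simp add: Cst_mult)
  qed
  have "ev k (v2 n) p = (\<Sum>t\<in>{0..2*n}. Cst (1 / of_nat (fact t)) * wop k (u t) p)"
    unfolding v2_def u_def[symmetric] by (rule ev_lincomb) simp
  also have "\<dots> = (\<Sum>t\<in>{0..2*n}. if t = 0 then Cst (fact (2 * n) * fact n) else 0)"
    by (intro sum.cong) (auto simp: pos zero)
  also have "\<dots> = Cst (fact (2 * n) * fact n)"
    by simp
  finally show False
    using const_term_ev_Nid[OF \<open>v2 n \<in> Nid k\<close>, of p] by simp
qed

section \<open>The vacuum modules\<close>

lemma fsub_self [simp]: "fsub p p = fzero"
  by (simp add: fsub_def fzero_def)

lemma Nid_fsub_trans:
  assumes "fsub p q \<in> Nid k" "fsub q r \<in> Nid k"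
  shows "fsub p r \<in> Nid k"
  using Nid.add[OF assms] by (simp add: fsub_def fadd_def)

lemma Nid_fsub_sym: "fsub p q \<in> Nid k \<Longrightarrow> fsub q p \<in> Nid k"
  using fsmul_Nid[of "fsub p q" k "-1"] by (simp add: fsub_def fsmul_def)

lemma rels_left:
  assumes "r \<in> rels" "fin p"
  shows "fmul r p \<in> Nid k"
  using Nid.rel[OF assms(1) fin_mon assms(2), of "[]" k] by simp

text \<open>Centrality moves \<open>c\<close> to the right end of each word, where the vacuum
  condition replaces it by \<open>k\<close>.\<close>

lemma cc_central:
  assumes "fin p"
  shows "fsub (fmul cc p) (fsmul k p) \<in> Nid k"
proof -
  \<comment> \<open>For the letter \<open>Cc\<close> the difference is zero rather than a listed
    relation.\<close>
  have gen: "fsub (fmul cc (mon [g])) (fmul (mon [g]) cc) \<in> insert fzero rels" for g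
    by (cases g) (auto simp: rels_def gm_def cc_def fmul_mon)
  have "fsub (fmul cc (mon w)) (fmul (mon w) cc) \<in> Nid k" for w
  proof (induction w)
    case Nil
    then show ?case by (simp add: Nid.zero)
  next
    case (Cons g w)
    have w: "mon (g # w) = fmul (mon [g]) (mon w)"
      by (simp add: fmul_mon)
    have "fmul (fsub (fmul cc (mon [g])) (fmul (mon [g]) cc)) (mon w) \<in> Nid k"
      using gen[of g] rels_left[of _ "mon w" k] by (auto simp: Nid.zero)
    moreover have "fmul (mon [g]) (fsub (fmul cc (mon w)) (fmul (mon w) cc)) \<in> Nid k"
      by (rule fmul_Nid[OF Cons]) simp
    ultimately show ?case
      unfolding w fmul_fsub_left fmul_fsub_right fmul_assoc by (rule Nid_fsub_trans)
  qed
  moreover have "fsub (fmul (mon w) cc) (fsmul k (mon w)) \<in> Nid k" for w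
    using Nid.ann[of "fsub cc (fsmul k (mon []))" k "mon w"]
    by (simp add: anns_def fmul_fsub_right fmul_fsmul_right)
  ultimately have mon: "fsub (fmul cc (mon w)) (fsmul k (mon w)) \<in> Nid k" for w
    by (meson Nid_fsub_trans)
  show ?thesis
    using assms
  proof (induction p rule: fin_induct)
    case zero
    have "fsmul k fzero = fzero"
      by (simp add: fsmul_def fzero_def)
    then show ?case by (simp add: Nid.zero)
  next
    case (add c w q)
    have "fsub (fmul cc (fadd (fsmul c (mon w)) q)) (fsmul k (fadd (fsmul c (mon w)) q)) =
        fadd (fsmul c (fsub (fmul cc (mon w)) (fsmul k (mon w)))) (fsub (fmul cc q) (fsmul k q))"
      unfolding fmul_fadd_right fmul_fsmul_right
      by (simp add: fsub_def fadd_def fsmul_def fun_eq_iff algebra_simps)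
    with add mon show ?case
      by (simp add: Nid.add fsmul_Nid)
  qed
qed

definition Veq :: "(complex \<Rightarrow> elt) \<Rightarrow> (complex \<Rightarrow> elt) \<Rightarrow> bool" where
  "Veq p q \<longleftrightarrow> (\<forall>k. fin (p k) \<and> fin (q k) \<and> fsub (p k) (q k) \<in> Nid k)"

text \<open>The modules for all levels \<open>k\<close> at once, because a quotient type cannot depend on \<open>k\<close>.\<close>

quotient_type vmod = "complex \<Rightarrow> elt" / partial: Veq
proof (rule part_equivpI)
  show "\<exists>p. Veq p p"
    by (rule exI[of _ "\<lambda>_. fzero"]) (simp add: Veq_def Nid.zero)
  show "symp Veq"
    by (auto simp: symp_def Veq_def Nid_fsub_sym)
  show "transp Veq"
    unfolding transp_def Veq_def by (blast intro: Nid_fsub_trans)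
qed

lemma Veq_refl_iff: "Veq p p \<longleftrightarrow> (\<forall>k. fin (p k))"
  by (simp add: Veq_def Nid.zero)

instantiation vmod :: ab_group_add
begin

lift_definition zero_vmod :: vmod is "\<lambda>_. fzero"
  by (simp add: Veq_refl_iff)

lift_definition plus_vmod :: "vmod \<Rightarrow> vmod \<Rightarrow> vmod" is "\<lambda>p q k. fadd (p k) (q k)"
proof -
  fix p p' q q' assume *: "Veq p p'" "Veq q q'"
  have "fsub (fadd (p k) (q k)) (fadd (p' k) (q' k)) = fadd (fsub (p k) (p' k)) (fsub (q k) (q' k))" for k
    by (simp add: fsub_def fadd_def fun_eq_iff)
  with * show "Veq (\<lambda>k. fadd (p k) (q k)) (\<lambda>k. fadd (p' k) (q' k))"
    by (auto simp: Veq_def Nid.add)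
qed

lift_definition minus_vmod :: "vmod \<Rightarrow> vmod \<Rightarrow> vmod" is "\<lambda>p q k. fsub (p k) (q k)"
proof -
  fix p p' q q' assume *: "Veq p p'" "Veq q q'"
  have "fsub (fsub (p k) (q k)) (fsub (p' k) (q' k)) = fsub (fsub (p k) (p' k)) (fsub (q k) (q' k))" for k
    by (simp add: fsub_def fun_eq_iff)
  with * show "Veq (\<lambda>k. fsub (p k) (q k)) (\<lambda>k. fsub (p' k) (q' k))"
    by (auto simp: Veq_def fsub_Nid)
qed

lift_definition uminus_vmod :: "vmod \<Rightarrow> vmod" is "\<lambda>p k. fsmul (-1) (p k)"
proof -
  fix p p' assume *: "Veq p p'"
  have "fsub (fsmul (-1) (p k)) (fsmul (-1) (p' k)) = fsmul (-1) (fsub (p k) (p' k))" for k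
    by (simp add: fsub_def fsmul_def fun_eq_iff)
  with * show "Veq (\<lambda>k. fsmul (-1) (p k)) (\<lambda>k. fsmul (-1) (p' k))"
    by (auto simp: Veq_def fsmul_Nid)
qed

lemma VeqI: "(\<And>k. fin (p k)) \<Longrightarrow> (\<And>k. fin (q k)) \<Longrightarrow> (\<And>k w. p k w = q k w) \<Longrightarrow> Veq p q"
proof -
  assume *: "\<And>k. fin (p k)" "\<And>k w. p k w = q k w"
  then have "p = q" by (simp add: fun_eq_iff)
  with * show ?thesis by (simp add: Veq_refl_iff)
qed

instance
proof
  fix a b c :: vmod
  show "a + b + c = a + (b + c)"
    by transfer (rule VeqI; simp add: Veq_refl_iff; simp add: fadd_def)
  show "a + b = b + a"
    by transfer (rule VeqI; simp add: Veq_refl_iff; simp add: fadd_def)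
  show "0 + a = a"
    by transfer (rule VeqI; simp add: Veq_refl_iff; simp add: fadd_def fzero_def)
  show "- a + a = 0"
    by transfer (rule VeqI; simp add: Veq_refl_iff; simp add: fadd_def fsmul_def fzero_def)
  show "a - b = a + - b"
    by transfer (rule VeqI; simp add: Veq_refl_iff; simp add: fadd_def fsmul_def fsub_def)
qed

end

lift_definition scl :: "complex \<Rightarrow> vmod \<Rightarrow> vmod" is "\<lambda>c p k. fsmul c (p k)"
proof -
  fix c p p' assume *: "Veq p p'"
  have "fsub (fsmul c (p k)) (fsmul c (p' k)) = fsmul c (fsub (p k) (p' k))" for k
    by (simp add: fsub_def fsmul_def fun_eq_iff algebra_simps)
  with * show "Veq (\<lambda>k. fsmul c (p k)) (\<lambda>k. fsmul c (p' k))"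
    by (auto simp: Veq_def fsmul_Nid)
qed

text \<open>The action of the central element, kept as an operator so that the bracket formula is
  uniform in the level.\<close>

lift_definition level :: "vmod \<Rightarrow> vmod" is "\<lambda>p k. fsmul k (p k)"
proof -
  fix p p' assume *: "Veq p p'"
  have "fsub (fsmul k (p k)) (fsmul k (p' k)) = fsmul k (fsub (p k) (p' k))" for k
    by (simp add: fsub_def fsmul_def fun_eq_iff algebra_simps)
  with * show "Veq (\<lambda>k. fsmul k (p k)) (\<lambda>k. fsmul k (p' k))"
    by (auto simp: Veq_def fsmul_Nid)
qed

lift_definition act :: "gen \<Rightarrow> vmod \<Rightarrow> vmod" is "\<lambda>g p k. fmul (mon [g]) (p k)"
  by (auto simp: Veq_def fmul_fsub_right[symmetric] fmul_Nid)

lift_definition vac :: vmod is "\<lambda>_. mon []"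
  by (simp add: Veq_refl_iff)

lift_definition cls :: "elt \<Rightarrow> vmod" is "\<lambda>p _. if fin p then p else fzero"
  by (simp add: Veq_refl_iff)

lift_definition zero_at :: "complex \<Rightarrow> vmod \<Rightarrow> bool" is "\<lambda>k p. p k \<in> Nid k"
proof -
  fix k p p' assume *: "Veq p p'"
  have "p k = fadd (p' k) (fsub (p k) (p' k))" "p' k = fsub (p k) (fsub (p k) (p' k))"
    by (simp_all add: fadd_def fsub_def fun_eq_iff)
  with * show "(p k \<in> Nid k) = (p' k \<in> Nid k)"
    unfolding Veq_def by (metis Nid.add fsub_Nid)
qed

interpretation vs: vector_space scl
proof
  fix a b :: complex and x y :: vmod
  show "scl a (x + y) = scl a x + scl a y"
    by transfer (rule VeqI; simp add: Veq_refl_iff; simp add: fadd_def fsmul_def algebra_simps)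
  show "scl (a + b) x = scl a x + scl b x"
    by transfer (rule VeqI; simp add: Veq_refl_iff; simp add: fadd_def fsmul_def algebra_simps)
  show "scl a (scl b x) = scl (a * b) x"
    by transfer (rule VeqI; simp add: Veq_refl_iff; simp add: fsmul_def algebra_simps)
  show "scl 1 x = x"
    by transfer (rule VeqI; simp add: Veq_refl_iff; simp add: fsmul_def)
qed

lemma act_add: "act g (x + y) = act g x + act g y"
  by transfer (rule VeqI; simp add: Veq_refl_iff fmul_fadd_right)

lemma act_scl: "act g (scl c x) = scl c (act g x)"
  by transfer (rule VeqI; simp add: Veq_refl_iff fmul_fsmul_right)

lemma act_level: "act g (level x) = level (act g x)"
  by transfer (rule VeqI; simp add: Veq_refl_iff fmul_fsmul_right)

lemma act_lincomb:
  assumes "x \<in> sl3" "y \<in> sl3"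
  shows "act (G (msc a x + msc b y) m) v = scl a (act (G x m) v) + scl b (act (G y m) v)"
proof (transfer fixing: a b x y m)
  fix p assume "Veq p p"
  let ?r = "fsub (gm (msc a x + msc b y) m) (fadd (fsmul a (gm x m)) (fsmul b (gm y m)))"
  have "?r \<in> rels"
    using assms unfolding rels_def by blast
  then have "fmul ?r (p k) \<in> Nid k" for k
    using \<open>Veq p p\<close> by (simp add: rels_left Veq_refl_iff)
  then show "Veq (\<lambda>k. fmul (mon [G (msc a x + msc b y) m]) (p k))
      (\<lambda>k. fadd (fsmul a (fmul (mon [G x m]) (p k))) (fsmul b (fmul (mon [G y m]) (p k))))"
    using \<open>Veq p p\<close>
    by (simp add: Veq_refl_iff) (simp add: Veq_def fmul_fsub_left fmul_fadd_left fmul_fsmul_left gm_def)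
qed

lemma act_bracket:
  assumes "x \<in> sl3" "y \<in> sl3"
  shows "act (G x m) (act (G y n) v) = act (G y n) (act (G x m) v) + act (G (lbr x y) (m + n)) v
    + scl (if m + n = 0 then of_int m * trace (x ** y) else 0) (level v)"
proof (transfer fixing: x y m n)
  fix p assume p: "Veq p p"
  define c where "c = (if m + n = 0 then of_int m * trace (x ** y) else 0)"
  let ?r = "fsub (fsub (fmul (gm x m) (gm y n)) (fmul (gm y n) (gm x m)))
           (fadd (gm (lbr x y) (m + n)) (fsmul c cc))"
  have r: "?r \<in> rels"
    using assms unfolding rels_def c_def by blast
  have "fsub (fmul (gm x m) (fmul (gm y n) (p k)))
      (fadd (fadd (fmul (gm y n) (fmul (gm x m) (p k))) (fmul (gm (lbr x y) (m + n)) (p k)))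
        (fsmul c (fsmul k (p k)))) \<in> Nid k" for k
  proof -
    have "fin (p k)" using p by (simp add: Veq_refl_iff)
    \<comment> \<open>The relation contains \<open>cc\<close>; adding a multiple of
      \<open>cc_central\<close> replaces it by \<open>k\<close>.\<close>
    then have "fadd (fmul ?r (p k)) (fsmul c (fsub (fmul cc (p k)) (fsmul k (p k)))) \<in> Nid k"
      using r by (intro Nid.add fsmul_Nid cc_central rels_left)
    moreover have "fadd (fmul ?r (p k)) (fsmul c (fsub (fmul cc (p k)) (fsmul k (p k)))) =
        fsub (fmul (gm x m) (fmul (gm y n) (p k)))
      (fadd (fadd (fmul (gm y n) (fmul (gm x m) (p k))) (fmul (gm (lbr x y) (m + n)) (p k)))
        (fsmul c (fsmul k (p k))))"
      unfolding fmul_fsub_left fmul_fadd_left fmul_fsmul_left fmul_assoc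
      by (simp add: fun_eq_iff fadd_def fsub_def fsmul_def algebra_simps)
    ultimately show ?thesis by simp
  qed
  then show "Veq (\<lambda>k. fmul (mon [G x m]) (fmul (mon [G y n]) (p k)))
      (\<lambda>k. fadd (fadd (fmul (mon [G y n]) (fmul (mon [G x m]) (p k)))
        (fmul (mon [G (lbr x y) (m + n)]) (p k)))
        (fsmul (if m + n = 0 then of_int m * trace (x ** y) else 0) (fsmul k (p k))))"
    using p unfolding c_def[symmetric] Veq_def gm_def by simp
qed

lemma act_vac:
  assumes "x \<in> sl3" "m \<ge> 0"
  shows "act (G x m) vac = 0"
proof (transfer fixing: x m)
  have "gm x m \<in> anns k" for k
    using assms unfolding anns_def by blast
  from Nid.ann[OF this, of "mon []"] show "Veq (\<lambda>k. fmul (mon [G x m]) (mon [])) (\<lambda>_. fzero)"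
    by (simp add: Veq_def gm_def) (simp add: fsub_def fzero_def)
qed

lemma zero_at_add: "zero_at k x \<Longrightarrow> zero_at k y \<Longrightarrow> zero_at k (x + y)"
  by transfer (rule Nid.add)

lemma zero_at_0 [simp]: "zero_at k 0"
  by transfer (rule Nid.zero)

lemma zero_at_scl: "zero_at k x \<Longrightarrow> zero_at k (scl c x)"
  by transfer (rule fsmul_Nid)

lemma zero_at_act: "zero_at k x \<Longrightarrow> zero_at k (act g x)"
  by transfer (simp add: fmul_Nid)

lemma zero_at_level: "zero_at k (scl k x - level x)"
  by transfer (simp add: Nid.zero)

lemma zero_at_cls: "fin p \<Longrightarrow> zero_at k (cls p) \<longleftrightarrow> p \<in> Nid k"
  by transfer simp

lemma cls_fmul: "fin p \<Longrightarrow> cls (fmul (mon [g]) p) = act g (cls p)"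
  by transfer (simp add: Veq_refl_iff)

lemma cls_fadd: "fin p \<Longrightarrow> fin q \<Longrightarrow> cls (fadd p q) = cls p + cls q"
  by transfer (simp add: Veq_refl_iff)

lemma cls_fsub: "fin p \<Longrightarrow> fin q \<Longrightarrow> cls (fsub p q) = cls p - cls q"
  by transfer (simp add: Veq_refl_iff)

lemma cls_fsmul: "fin p \<Longrightarrow> cls (fsmul c p) = scl c (cls p)"
  by transfer (simp add: Veq_refl_iff)

lemma cls_fzero: "cls fzero = 0"
  by transfer (simp add: Veq_refl_iff)

lemma cls_mon: "cls (mon w) = foldr act w vac"
proof (induction w)
  case Nil
  then show ?case by simp (transfer, simp add: Veq_refl_iff)
next
  case (Cons g w)
  then show ?case using cls_fmul[of "mon w" g] by (simp add: fmul_mon)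
qed

lemma cls_lincomb:
  "finite A \<Longrightarrow> cls (\<lambda>w. \<Sum>s\<in>A. c s * mon (u s) w) = (\<Sum>s\<in>A. scl (c s) (foldr act (u s) vac))"
proof (induction A rule: finite_induct)
  case empty
  then show ?case using cls_fzero by (simp add: fzero_def)
next
  case (insert t A)
  then show ?case
    unfolding lincomb_insert[OF insert.hyps(1,2)]
    by (simp add: cls_fadd cls_fsmul fin_lincomb cls_mon)
qed

section \<open>Annihilation by the positive part\<close>

lemma act_0 [simp]: "act g 0 = 0"
  using act_scl[of g 0 0] by simp

lemma act_minus: "act g (- x) = - act g x"
  using act_scl[of g "-1" x] by simp

lemma act_diff: "act g (x - y) = act g x - act g y"
  using act_add[of g x "- y"] by (simp add: act_minus)

lemma act_sum: "act g (sum f A) = (\<Sum>i\<in>A. act g (f i))"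
  by (induction A rule: infinite_finite_induct) (simp_all add: act_add)

lemma act_pow_add: "(act g ^^ j) (x + y) = (act g ^^ j) x + (act g ^^ j) y"
  by (induction j) (simp_all add: act_add)

lemma act_pow_scl: "(act g ^^ j) (scl c x) = scl c ((act g ^^ j) x)"
  by (induction j) (simp_all add: act_scl)

lemma act_pow_0 [simp]: "(act g ^^ j) 0 = 0"
  by (induction j) simp_all

lemma act_pow_minus: "(act g ^^ j) (- x) = - (act g ^^ j) x"
  by (induction j) (simp_all add: act_minus)

lemma act_pow_diff: "(act g ^^ j) (x - y) = (act g ^^ j) x - (act g ^^ j) y"
  by (induction j) (simp_all add: act_diff)

lemma zero_at_sum: "(\<And>i. i \<in> A \<Longrightarrow> zero_at k (f i)) \<Longrightarrow> zero_at k (sum f A)"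
  by (induction A rule: infinite_finite_induct) (simp_all add: zero_at_add)

lemma pow_commute:
  assumes "\<And>v. X (Y v) = Y (X v)"
  shows "X ((Y ^^ j) v) = (Y ^^ j) (X v)"
  by (induction j) (simp_all add: assms)

text \<open>Each of the \<open>j\<close> factors \<open>y\<close> can turn into \<open>c z\<close>,
  and \<open>z\<close> moves freely to the right. For \<open>j = 0\<close> the truncated exponent
  comes with coefficient 0.\<close>

lemma act_pow_bracket:
  assumes XY: "\<And>v. act x (act y v) = act y (act x v) + scl c (act z v)"
    and ZY: "\<And>v. act z (act y v) = act y (act z v)"
  shows "act x ((act y ^^ j) v) = (act y ^^ j) (act x v) + scl (of_nat j * c) ((act y ^^ (j - 1)) (act z v))"
proof (induction j)
  case (Suc j)
  have "act x ((act y ^^ Suc j) v) = act y (act x ((act y ^^ j) v)) + scl c ((act y ^^ j) (act z v))"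
    using pow_commute[of "act z" "act y" j v] by (simp add: XY ZY)
  also have "\<dots> = (act y ^^ Suc j) (act x v) + scl (of_nat (Suc j) * c) ((act y ^^ j) (act z v))"
  proof -
    have "act y (scl (of_nat j * c) ((act y ^^ (j - 1)) (act z v))) =
        scl (of_nat j * c) ((act y ^^ j) (act z v))"
      by (cases j) (simp_all add: act_scl)
    moreover have "of_nat (Suc j) * c = of_nat j * c + c"
      by (simp add: algebra_simps)
    ultimately show ?thesis
      unfolding Suc by (simp only: vs.scale_left_distrib act_add funpow.simps o_apply add.assoc)
  qed
  finally show ?case by simp
qed simp

lemma act_bracket_simple:
  assumes "x \<in> sl3" "y \<in> sl3" "z \<in> sl3" "lbr x y = msc c z"
    and "m + n \<noteq> 0 \<or> m = 0 \<or> trace (x ** y) = 0"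
  shows "act (G x m) (act (G y n) v) = act (G y n) (act (G x m) v) + scl c (act (G z (m + n)) v)"
proof -
  have "msc c z + msc 0 z = msc c z"
    by (simp add: vec_eq_iff msc_nth)
  then have "act (G (lbr x y) (m + n)) v = scl c (act (G z (m + n)) v)"
    using act_lincomb[OF assms(3,3), of c 0] assms(4) by simp
  then show ?thesis
    using assms(5) by (subst act_bracket[OF assms(1,2)]) auto
qed

definition hdiff :: "3 \<Rightarrow> 3 \<Rightarrow> complex^3^3" where
  "hdiff i j = Emat i i - Emat j j"

lemma hdiff_in_sl3: "hdiff i j \<in> sl3"
  by (simp add: sl3_def hdiff_def trace_def Emat_nth sum_subtractf)

text \<open>\<open>sum_3\<close> and \<open>forall_3\<close> enumerate the indices as 1, 2,
  3.\<close>

lemma three_eq_0 [simp]: "(3::3) = 0"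
  by simp

lemmas mat3_simps = vec_eq_iff forall_3 lbr_def matrix_matrix_mult_def sum_3 Emat_nth msc_nth
  trace_def e12_def e23_def e13_def f12_def hdiff_def

lemmas in_sl3 = root_vectors_in_sl3 Emat_in_sl3 hdiff_in_sl3

text \<open>In the names of the following commutation rules, \<open>e\<close>, \<open>g\<close>, \<open>s\<close> and \<open>y\<close> stand for the operators
  \<open>e\<^sub>1\<^sub>2(0)\<close>, \<open>e\<^sub>2\<^sub>3(0)\<close>, \<open>E\<^sub>3\<^sub>1(1)\<close> and \<open>E\<^sub>3\<^sub>2(0)\<close>.\<close>

abbreviation "opA \<equiv> act (G e12 (-1))"
abbreviation "opB \<equiv> act (G e23 (-1))"
abbreviation "opD \<equiv> act (G e13 (-1))"
abbreviation "opF \<equiv> act (G f12 0)"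

lemma F_D: "opF (opD v) = opD (opF v) + scl (-1) (opB v)"
  using act_bracket_simple[of f12 e13 e23 "-1" 0 "-1" v] by (simp add: in_sl3) (simp add: mat3_simps)

lemma F_B: "opF (opB v) = opB (opF v)"
  using act_bracket_simple[of f12 e23 e23 0 0 "-1" v] by (simp add: in_sl3) (simp add: mat3_simps)

lemma F_A: "opF (opA v) = opA (opF v) + scl (-1) (act (G (hdiff 0 1) (-1)) v)"
  using act_bracket_simple[of f12 e12 "hdiff 0 1" "-1" 0 "-1" v] by (simp add: in_sl3) (simp add: mat3_simps)

lemma F_H: "opF (act (G (hdiff 0 1) (-1)) v) = act (G (hdiff 0 1) (-1)) (opF v) + scl 2 (act (G f12 (-1)) v)"
  using act_bracket_simple[of f12 "hdiff 0 1" f12 2 0 "-1" v] by (simp add: in_sl3) (simp add: mat3_simps)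

lemma F_F: "opF (act (G f12 (-1)) v) = act (G f12 (-1)) (opF v)"
  using act_bracket_simple[of f12 f12 f12 0 0 "-1" v] by (simp add: in_sl3) (simp add: mat3_simps)

lemma B_D: "opB (opD v) = opD (opB v)"
  using act_bracket_simple[of e23 e13 e13 0 "-1" "-1" v] by (simp add: in_sl3) (simp add: mat3_simps)

lemma e_D: "act (G e12 0) (opD v) = opD (act (G e12 0) v)"
  using act_bracket_simple[of e12 e13 e13 0 0 "-1" v] by (simp add: in_sl3) (simp add: mat3_simps)

lemma e_B: "act (G e12 0) (opB v) = opB (act (G e12 0) v) + scl (-1) (opD v)"
  using act_bracket_simple[of e12 e23 e13 "-1" 0 "-1" v] by (simp add: in_sl3) (simp add: mat3_simps)

lemma e_A: "act (G e12 0) (opA v) = opA (act (G e12 0) v)"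
  using act_bracket_simple[of e12 e12 e12 0 0 "-1" v] by (simp add: in_sl3) (simp add: mat3_simps)

lemma e_F: "act (G e12 0) (opF v) = opF (act (G e12 0) v) + act (G (hdiff 0 1) 0) v"
  using act_bracket_simple[of e12 f12 "hdiff 0 1" 1 0 0 v] by (simp add: in_sl3) (simp add: mat3_simps)

lemma g_D: "act (G e23 0) (opD v) = opD (act (G e23 0) v)"
  using act_bracket_simple[of e23 e13 e13 0 0 "-1" v] by (simp add: in_sl3) (simp add: mat3_simps)

lemma g_B: "act (G e23 0) (opB v) = opB (act (G e23 0) v)"
  using act_bracket_simple[of e23 e23 e23 0 0 "-1" v] by (simp add: in_sl3) (simp add: mat3_simps)

lemma g_F: "act (G e23 0) (opF v) = opF (act (G e23 0) v)"
  using act_bracket_simple[of e23 f12 f12 0 0 0 v] by (simp add: in_sl3) (simp add: mat3_simps)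

lemma g_A: "act (G e23 0) (opA v) = opA (act (G e23 0) v) + scl 1 (opD v)"
  using act_bracket_simple[of e23 e12 e13 1 0 "-1" v] by (simp add: in_sl3) (simp add: mat3_simps)

lemma D_A: "opD (opA v) = opA (opD v)"
  using act_bracket_simple[of e13 e12 e12 0 "-1" "-1" v] by (simp add: in_sl3) (simp add: mat3_simps)

lemma s_B: "act (G (Emat 2 0) 1) (opB v) = opB (act (G (Emat 2 0) 1) v) + scl (-1) (opF v)"
  using act_bracket_simple[of "Emat 2 0" e23 f12 "-1" 1 "-1" v] by (simp add: in_sl3) (simp add: mat3_simps)

lemma s_F: "act (G (Emat 2 0) 1) (opF v) = opF (act (G (Emat 2 0) 1) v)"
  using act_bracket_simple[of "Emat 2 0" f12 f12 0 1 0 v] by (simp add: in_sl3) (simp add: mat3_simps)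

lemma s_A: "act (G (Emat 2 0) 1) (opA v) = opA (act (G (Emat 2 0) 1) v) + scl 1 (act (G (Emat 2 1) 0) v)"
  using act_bracket_simple[of "Emat 2 0" e12 "Emat 2 1" 1 1 "-1" v] by (simp add: in_sl3) (simp add: mat3_simps)

lemma y_A: "act (G (Emat 2 1) 0) (opA v) = opA (act (G (Emat 2 1) 0) v)"
  using act_bracket_simple[of "Emat 2 1" e12 e12 0 0 "-1" v] by (simp add: in_sl3) (simp add: mat3_simps)

text \<open>The only one of these rules with a nonzero central term: the degrees 1 and -1 cancel and
  the trace is -1.\<close>

lemma s_D: "act (G (Emat 2 0) 1) (opD v) =
    opD (act (G (Emat 2 0) 1) v) + act (G (hdiff 0 2) 0) v - level v"
proof -
  have "lbr (Emat 2 0) e13 = hdiff 0 2" "trace (Emat 2 0 ** e13) = -1"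
    by (simp_all add: mat3_simps)
  then show ?thesis
    using act_bracket[of "Emat 2 0" e13 1 "-1" v] by (simp add: in_sl3)
qed

lemma cartan_in_sl3: "h \<in> cartan \<Longrightarrow> h \<in> sl3"
  by (simp add: cartan_def)

lemma hdiff_in_cartan: "hdiff i j \<in> cartan"
  using hdiff_in_sl3[of i j] by (auto simp: cartan_def hdiff_def Emat_nth)

lemma weight_pow:
  assumes "h \<in> sl3" "x \<in> sl3" "lbr h x = msc \<mu> x" "act (G h 0) v = scl \<nu> v"
  shows "act (G h 0) ((act (G x m) ^^ j) v) = scl (\<nu> + of_nat j * \<mu>) ((act (G x m) ^^ j) v)"
proof (induction j)
  case (Suc j)
  have "act (G h 0) ((act (G x m) ^^ Suc j) v) =
      scl (\<nu> + of_nat j * \<mu>) ((act (G x m) ^^ Suc j) v) + scl \<mu> ((act (G x m) ^^ Suc j) v)"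
    using act_bracket_simple[OF assms(1,2,2,3), of 0 m "(act (G x m) ^^ j) v"]
    by (simp add: Suc act_scl)
  also have "\<dots> = scl (\<nu> + of_nat (Suc j) * \<mu>) ((act (G x m) ^^ Suc j) v)"
    unfolding vs.scale_left_distrib[symmetric] by (simp add: algebra_simps)
  finally show ?case .
qed (use assms in simp)

section \<open>Words in the four operators\<close>

definition hw :: "nat \<Rightarrow> vmod" where
  "hw n = (opA ^^ n) vac"

text \<open>The exponents are independent because a commutator changes them separately and breaks
  the relations that hold between them in the summands of the vector.\<close>

definition mword :: "nat \<Rightarrow> nat \<Rightarrow> nat \<Rightarrow> nat \<Rightarrow> vmod" where
  "mword n t s u = (opD ^^ t) ((opB ^^ s) ((opF ^^ u) (hw n)))"

lemma lbr_cartan: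
  assumes "h \<in> cartan"
  shows "lbr h e12 = msc (h$0$0 - h$1$1) e12" "lbr h e23 = msc (h$1$1 - h$2$2) e23"
    "lbr h e13 = msc (h$0$0 - h$2$2) e13" "lbr h f12 = msc (h$1$1 - h$0$0) f12"
  using assms by (simp_all add: mat3_simps cartan_def)

lemma weight_mword:
  assumes "h \<in> cartan"
  shows "act (G h 0) (mword n t s u) = scl (of_nat n * (h$0$0 - h$1$1) + of_nat u * (h$1$1 - h$0$0)
    + of_nat s * (h$1$1 - h$2$2) + of_nat t * (h$0$0 - h$2$2)) (mword n t s u)"
proof -
  have h: "h \<in> sl3" using assms by (rule cartan_in_sl3)
  have "act (G h 0) vac = scl 0 vac"
    using h by (simp add: act_vac)
  note 1 = weight_pow[OF h root_vectors_in_sl3(1) lbr_cartan(1)[OF assms] this, where m = "-1" and j = n]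
  note 2 = weight_pow[OF h root_vectors_in_sl3(4) lbr_cartan(4)[OF assms] 1, where m = 0 and j = u]
  note 3 = weight_pow[OF h root_vectors_in_sl3(2) lbr_cartan(2)[OF assms] 2, where m = "-1" and j = s]
  note 4 = weight_pow[OF h root_vectors_in_sl3(3) lbr_cartan(3)[OF assms] 3, where m = "-1" and j = t]
  then show ?thesis
    by (simp add: mword_def hw_def)
qed

text \<open>Bracketing with \<open>f12(0)\<close> takes \<open>e12(-1)\<close> to a multiple of
  \<open>hdiff 0 1\<close> in degree -1, then to a multiple of \<open>f12(-1)\<close>, then to 0. By
  the Leibniz rule one factor \<open>opA\<close> absorbs at most two \<open>opF\<close>.\<close>

lemma F_pow_nilpotent:
  "(opF ^^ j) v = 0 \<Longrightarrow> (opF ^^ (j + 2)) (opA v) = 0"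
proof -
  have F': "(opF ^^ j) v = 0 \<Longrightarrow> (opF ^^ j) (act (G f12 (-1)) v) = 0" for j v
    using pow_commute[of "act (G f12 (-1))" opF j v] F_F by simp
  have H: "(opF ^^ j) v = 0 \<Longrightarrow> (opF ^^ (j + 1)) (act (G (hdiff 0 1) (-1)) v) = 0" for j v
  proof (induction j arbitrary: v)
    case (Suc j)
    have "(opF ^^ j) (opF v) = 0"
      using Suc.prems by (simp add: funpow_swap1)
    note IH = Suc.IH[OF this]
    have "(opF ^^ (Suc j + 1)) (act (G (hdiff 0 1) (-1)) v) =
        (opF ^^ (j + 1)) (opF (act (G (hdiff 0 1) (-1)) v))"
      by (simp only: add_Suc funpow_Suc_right o_apply)
    also have "\<dots> = 0"
      unfolding F_H act_pow_add act_pow_scl IH using F'[OF Suc.prems] by simp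
    finally show ?case .
  qed simp
  show "(opF ^^ j) v = 0 \<Longrightarrow> (opF ^^ (j + 2)) (opA v) = 0"
  proof (induction j arbitrary: v)
    case (Suc j)
    have "(opF ^^ j) (opF v) = 0"
      using Suc.prems by (simp add: funpow_swap1)
    note IH = Suc.IH[OF this]
    have "(opF ^^ (Suc j + 2)) (opA v) = (opF ^^ (j + 2)) (opF (opA v))"
      by (simp only: add_Suc funpow_Suc_right o_apply)
    also have "\<dots> = 0"
      unfolding F_A act_pow_add act_pow_scl IH using H[OF Suc.prems] by simp
    finally show ?case .
  qed simp
qed

text \<open>\<open>opF\<close> kills the vacuum, and each of the \<open>n\<close> factors
  \<open>opA\<close> costs two more.\<close>

lemma F_pow_hw_eq_0: "(opF ^^ (2 * n + 1)) (hw n) = 0"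
proof (induction n)
  case 0
  then show ?case by (simp add: hw_def act_vac root_vectors_in_sl3)
next
  case (Suc n)
  from F_pow_nilpotent[OF this] show ?case
    by (simp add: hw_def)
qed

lemma e_hw: "act (G e12 0) (hw n) = 0"
  unfolding hw_def using pow_commute[of "act (G e12 0)" opA n vac] e_A
  by (simp add: act_vac root_vectors_in_sl3)

text \<open>The standard sl2 formula: \<open>hw n\<close> is killed by \<open>e12(0)\<close> and has
  weight \<open>2 * n\<close> for \<open>hdiff 0 1\<close> in degree 0.\<close>

lemma e_F_pow_hw:
  "act (G e12 0) ((opF ^^ u) (hw n)) = scl (of_nat u * (2 * of_nat n - of_nat u + 1)) ((opF ^^ (u - 1)) (hw n))"
proof (induction u)
  case 0
  then show ?case by (simp add: e_hw)
next
  case (Suc u)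
  have h: "act (G (hdiff 0 1) 0) ((opF ^^ u) (hw n)) = scl (2 * of_nat n - 2 * of_nat u) ((opF ^^ u) (hw n))"
    using weight_mword[OF hdiff_in_cartan[of 0 1], of n 0 0 u]
    by (simp add: mword_def hdiff_def Emat_nth algebra_simps)
  have "act (G e12 0) ((opF ^^ Suc u) (hw n)) =
      opF (scl (of_nat u * (2 * of_nat n - of_nat u + 1)) ((opF ^^ (u - 1)) (hw n)))
      + scl (2 * of_nat n - 2 * of_nat u) ((opF ^^ u) (hw n))"
    by (simp add: e_F Suc h)
  also have "opF (scl (of_nat u * (2 * of_nat n - of_nat u + 1)) ((opF ^^ (u - 1)) (hw n))) =
      scl (of_nat u * (2 * of_nat n - of_nat u + 1)) ((opF ^^ u) (hw n))"
    by (cases u) (simp_all add: act_scl)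
  finally show ?case
    unfolding vs.scale_left_distrib[symmetric] by (simp add: algebra_simps)
qed

lemma e_mword: "act (G e12 0) (mword n t s u) =
    scl (of_nat u * (2 * of_nat n - of_nat u + 1)) (mword n t s (u - 1)) + scl (- of_nat s) (mword n (Suc t) (s - 1) u)"
proof -
  have DB: "opD (opB v) = opB (opD v)" for v
    by (simp add: B_D)
  let ?w = "(opF ^^ u) (hw n)"
  have "act (G e12 0) (mword n t s u) = (opD ^^ t) (act (G e12 0) ((opB ^^ s) ?w))"
    unfolding mword_def by (rule pow_commute) (rule e_D)
  also have "act (G e12 0) ((opB ^^ s) ?w) =
      (opB ^^ s) (act (G e12 0) ?w) + scl (of_nat s * (-1)) ((opB ^^ (s - 1)) (opD ?w))"
    by (rule act_pow_bracket) (rule e_B, rule DB)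
  also have "(opB ^^ (s - 1)) (opD ?w) = opD ((opB ^^ (s - 1)) ?w)"
    by (rule pow_commute[symmetric]) (rule DB)
  finally show ?thesis
    unfolding e_F_pow_hw by (simp add: mword_def act_pow_add act_pow_diff act_pow_scl funpow_swap1)
qed

lemma F_pow_D: "(opF ^^ u) (opD v) = opD ((opF ^^ u) v) + scl (- of_nat u) (opB ((opF ^^ (u - 1)) v))"
proof (induction u)
  case (Suc u)
  have "opF (scl (- of_nat u) (opB ((opF ^^ (u - 1)) v))) = scl (- of_nat u) (opB ((opF ^^ u) v))"
    by (cases u) (simp_all add: act_scl act_minus F_B)
  then have "(opF ^^ Suc u) (opD v) =
      opD ((opF ^^ Suc u) v) + (scl (-1) (opB ((opF ^^ u) v)) + scl (- of_nat u) (opB ((opF ^^ u) v)))"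
    by (simp only: funpow.simps o_apply Suc act_add F_D add.assoc)
  then show ?case
    unfolding vs.scale_left_distrib[symmetric] by simp
qed simp

text \<open>\<open>e23(0)\<close> passes everything except the factors \<open>opA\<close>, one of
  which becomes \<open>opD\<close>; moving this \<open>opD\<close> to the left through
  \<open>opF\<close> produces the second word.\<close>

lemma g_mword: "act (G e23 0) (mword n t s u) =
    scl (of_nat n) (mword (n - 1) (Suc t) s u) + scl (- of_nat n * of_nat u) (mword (n - 1) t (Suc s) (u - 1))"
proof -
  have BD: "opD (opB v) = opB (opD v)" for v
    by (simp add: B_D)
  have "act (G e23 0) (hw n) =
      (opA ^^ n) (act (G e23 0) vac) + scl (of_nat n * 1) ((opA ^^ (n - 1)) (opD vac))"
    unfolding hw_def by (rule act_pow_bracket) (rule g_A, rule D_A)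
  also have "(opA ^^ (n - 1)) (opD vac) = opD (hw (n - 1))"
    unfolding hw_def by (rule pow_commute[symmetric]) (rule D_A)
  finally have hw: "act (G e23 0) (hw n) = scl (of_nat n) (opD (hw (n - 1)))"
    by (simp add: act_vac root_vectors_in_sl3)
  have "act (G e23 0) (mword n t s u) = (opD ^^ t) ((opB ^^ s) ((opF ^^ u) (act (G e23 0) (hw n))))"
    unfolding mword_def
    by (simp add: pow_commute[of "act (G e23 0)" opD] pow_commute[of "act (G e23 0)" opB]
        pow_commute[of "act (G e23 0)" opF] g_D g_B g_F)
  also have "\<dots> = scl (of_nat n) ((opD ^^ t) ((opB ^^ s) (opD ((opF ^^ u) (hw (n - 1)))))) +
      scl (- of_nat n * of_nat u) ((opD ^^ t) ((opB ^^ s) (opB ((opF ^^ (u - 1)) (hw (n - 1))))))"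
    unfolding hw act_pow_scl F_pow_D by (simp add: act_pow_diff act_pow_scl vs.scale_right_diff_distrib)
  also have "(opB ^^ s) (opD ((opF ^^ u) (hw (n - 1)))) = opD ((opB ^^ s) ((opF ^^ u) (hw (n - 1))))"
    by (rule pow_commute[symmetric]) (rule BD)
  finally show ?thesis
    by (simp add: mword_def funpow_swap1)
qed

text \<open>The weight for \<open>hdiff 0 2\<close> rises by 2 with each \<open>opD\<close>, and the
  sum of \<open>\<nu> + 2 * i\<close> over \<open>i < t\<close> is
  \<open>t * (\<nu> + t - 1)\<close>.\<close>

lemma s_D_pow:
  assumes "act (G (hdiff 0 2) 0) v = scl \<nu> v"
  shows "act (G (Emat 2 0) 1) ((opD ^^ t) v) = (opD ^^ t) (act (G (Emat 2 0) 1) v) +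
    scl (of_nat t * (\<nu> + of_nat t - 1)) ((opD ^^ (t - 1)) v) - scl (of_nat t) (level ((opD ^^ (t - 1)) v))"
proof (induction t)
  case (Suc t)
  let ?s = "act (G (Emat 2 0) 1)" and ?w = "(opD ^^ t) v"
  have h: "act (G (hdiff 0 2) 0) ?w = scl (\<nu> + of_nat t * 2) ?w"
  proof (rule weight_pow)
    show "lbr (hdiff 0 2) e13 = msc 2 e13"
      by (simp add: mat3_simps)
  qed (simp_all add: in_sl3 assms)
  have "?s ((opD ^^ Suc t) v) = opD (?s ?w) + scl (\<nu> + of_nat t * 2) ?w - level ?w"
    by (simp add: s_D h)
  also have "opD (?s ?w) = (opD ^^ Suc t) (?s v) +
      scl (of_nat t * (\<nu> + of_nat t - 1)) ?w - scl (of_nat t) (level ?w)"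
    unfolding Suc by (cases t) (simp_all add: act_add act_diff act_scl act_level)
  finally have "?s ((opD ^^ Suc t) v) = (opD ^^ Suc t) (?s v) +
      (scl (of_nat t * (\<nu> + of_nat t - 1)) ?w + scl (\<nu> + of_nat t * 2) ?w)
      - (scl (of_nat t) (level ?w) + scl 1 (level ?w))"
    by simp
  also have "\<dots> = (opD ^^ Suc t) (?s v) +
      scl (of_nat (Suc t) * (\<nu> + of_nat (Suc t) - 1)) ?w - scl (of_nat (Suc t)) (level ?w)"
    unfolding vs.scale_left_distrib[symmetric] by (simp add: algebra_simps)
  finally show ?case by simp
qed simp

text \<open>The operator kills \<open>hw n\<close>, passes \<open>opF\<close> and turns one
  \<open>opB\<close> into \<open>- opF\<close>. The factors \<open>opD\<close> produce Cartan and
  level terms, the vector to their right having weight \<open>n + s - u\<close>.\<close>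

lemma s_mword: "act (G (Emat 2 0) 1) (mword n t s u) = scl (- of_nat s) (mword n t (s - 1) (Suc u)) +
    scl (of_nat t * (of_nat n + of_nat s - of_nat u + of_nat t - 1)) (mword n (t - 1) s u)
    - scl (of_nat t) (level (mword n (t - 1) s u))"
proof -
  let ?s = "act (G (Emat 2 0) 1)"
  have "?s (hw n) = (opA ^^ n) (?s vac) + scl (of_nat n * 1) ((opA ^^ (n - 1)) (act (G (Emat 2 1) 0) vac))"
    unfolding hw_def by (rule act_pow_bracket) (rule s_A, rule y_A)
  then have hw: "?s (hw n) = 0"
    by (simp add: act_vac in_sl3)
  have "?s ((opF ^^ u) (hw n)) = (opF ^^ u) (?s (hw n))"
    by (rule pow_commute) (rule s_F)
  then have F: "?s ((opF ^^ u) (hw n)) = 0"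
    by (simp add: hw)
  have "?s ((opB ^^ s) ((opF ^^ u) (hw n))) = (opB ^^ s) (?s ((opF ^^ u) (hw n))) +
      scl (of_nat s * (-1)) ((opB ^^ (s - 1)) (opF ((opF ^^ u) (hw n))))"
    by (rule act_pow_bracket) (rule s_B, rule F_B)
  then have B: "?s ((opB ^^ s) ((opF ^^ u) (hw n))) =
      scl (- of_nat s) ((opB ^^ (s - 1)) ((opF ^^ Suc u) (hw n)))"
    by (simp add: F)
  have h: "act (G (hdiff 0 2) 0) ((opB ^^ s) ((opF ^^ u) (hw n))) =
      scl (of_nat n + of_nat s - of_nat u) ((opB ^^ s) ((opF ^^ u) (hw n)))"
    using weight_mword[OF hdiff_in_cartan[of 0 2], of n 0 s u]
    by (simp add: mword_def hdiff_def Emat_nth algebra_simps)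
  show ?thesis
    unfolding mword_def s_D_pow[OF h] B by (simp add: act_pow_scl act_pow_minus)
qed

section \<open>The singular vector and its three annihilation identities\<close>

definition vsing :: "nat \<Rightarrow> vmod" where
  "vsing n = (\<Sum>t\<le>2*n. scl (1 / fact t) (mword n t (2 * n - t) t))"

text \<open>Regrouping by words: in the applications \<open>Y (Suc t)\<close> and \<open>X t\<close>
  are multiples of the same word, and \<open>X N\<close> is left over.\<close>

lemma sum_shift:
  fixes X Y :: "nat \<Rightarrow> 'a::ab_group_add"
  assumes "Y 0 = 0"
  shows "(\<Sum>t\<le>N. Y t + X t) = (\<Sum>t<N. Y (Suc t) + X t) + X N"
  using assms by (induction N) (simp_all add: algebra_simps)

lemma e_vsing: "act (G e12 0) (vsing n) = 0"
proof -
  define Y where "Y t = scl (1 / fact t) (scl (of_nat t * (2 * of_nat n - of_nat t + 1)) (mword n t (2 * n - t) (t - 1)))" for t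
  define X where "X t = scl (1 / fact t) (scl (- of_nat (2 * n - t)) (mword n (Suc t) (2 * n - t - 1) t))" for t
  have "act (G e12 0) (vsing n) = (\<Sum>t\<le>2*n. Y t + X t)"
    by (simp add: vsing_def act_sum act_scl e_mword vs.scale_right_distrib X_def Y_def)
  also have "\<dots> = (\<Sum>t<2*n. Y (Suc t) + X t) + X (2 * n)"
    by (rule sum_shift) (simp add: Y_def)
  also have "(\<Sum>t<2*n. Y (Suc t) + X t) = 0"
  proof (rule sum.neutral, rule ballI)
    fix t assume "t \<in> {..<2*n}"
    then have t: "of_nat (2 * n - t) = (2 * of_nat n - of_nat t :: complex)"
      by (simp add: of_nat_diff)
    have "1 / fact (Suc t) * (of_nat (Suc t) * (2 * of_nat n - of_nat (Suc t) + 1)) =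
        (1 / fact t * (2 * of_nat n - of_nat t) :: complex)"
      by (simp add: field_simps del: of_nat_Suc) (simp add: algebra_simps)
    note c = this
    define q where "q = mword n (Suc t) (2 * n - t - 1) t"
    have "Y (Suc t) = scl (1 / fact t * (2 * of_nat n - of_nat t)) q"
      unfolding Y_def vs.scale_scale c q_def by simp
    moreover have "X t = scl (- (1 / fact t * (2 * of_nat n - of_nat t))) q"
      unfolding X_def vs.scale_scale t q_def by (simp only: mult_minus_right)
    ultimately show "Y (Suc t) + X t = 0"
      by (simp only: vs.scale_minus_left add.right_inverse)
  qed
  \<comment> \<open>The leftover \<open>X (2 * n)\<close> has coefficient
    \<open>2 * n - 2 * n\<close>.\<close>
  finally show ?thesis
    by (simp add: X_def)
qed

lemma g_vsing: "act (G e23 0) (vsing n) = 0"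
proof -
  define Y where "Y t = scl (1 / fact t) (scl (- of_nat n * of_nat t) (mword (n - 1) t (Suc (2 * n - t)) (t - 1)))" for t
  define X where "X t = scl (1 / fact t) (scl (of_nat n) (mword (n - 1) (Suc t) (2 * n - t) t))" for t
  have "act (G e23 0) (vsing n) = (\<Sum>t\<le>2*n. Y t + X t)"
    by (simp add: vsing_def act_sum act_scl g_mword vs.scale_right_diff_distrib X_def Y_def)
  also have "\<dots> = (\<Sum>t<2*n. Y (Suc t) + X t) + X (2 * n)"
    by (rule sum_shift) (simp add: Y_def)
  also have "(\<Sum>t<2*n. Y (Suc t) + X t) = 0"
  proof (rule sum.neutral, rule ballI)
    fix t assume "t \<in> {..<2*n}"
    then have t: "Suc (2 * n - Suc t) = 2 * n - t"
      by auto
    have c: "1 / fact (Suc t) * (- of_nat n * of_nat (Suc t)) = (- (1 / fact t * of_nat n) :: complex)"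
      by (simp add: field_simps del: of_nat_Suc)
    show "Y (Suc t) + X t = 0"
      unfolding X_def Y_def vs.scale_scale t c by simp
  qed
  \<comment> \<open>The leftover word applies \<open>opF\<close> to \<open>hw (n - 1)\<close> with
    exponent \<open>2 * n\<close>, one more than \<open>F_pow_hw_eq_0\<close> needs; for
    \<open>n = 0\<close> the coefficient vanishes.\<close>
  also have "X (2 * n) = 0"
  proof (cases n)
    case (Suc m)
    have "(opF ^^ (2 * n)) (hw (n - 1)) = opF ((opF ^^ (2 * m + 1)) (hw m))"
      using Suc by simp
    also have "\<dots> = 0"
      by (simp only: F_pow_hw_eq_0 act_0)
    finally show ?thesis
      by (simp add: X_def mword_def)
  qed (simp add: X_def)
  finally show ?thesis by simp
qed

text \<open>The level matters here. The coefficients \<open>3 * n - t - 2\<close> and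
  \<open>- (2 * n - t)\<close> of a common word add up to \<open>n - 2\<close>, which
  \<open>level\<close> cancels exactly when it acts as \<open>n - 2\<close>.\<close>

lemma s_vsing: "zero_at (of_nat n - 2) (act (G (Emat 2 0) 1) (vsing n))"
proof -
  define Y where "Y t = scl (1 / fact t)
    (scl (of_nat t * (of_nat n + of_nat (2 * n - t) - of_nat t + of_nat t - 1)) (mword n (t - 1) (2 * n - t) t)
      - scl (of_nat t) (level (mword n (t - 1) (2 * n - t) t)))" for t
  define X where "X t = scl (1 / fact t) (scl (- of_nat (2 * n - t)) (mword n t (2 * n - t - 1) (Suc t)))" for t
  have "act (G (Emat 2 0) 1) (vsing n) = (\<Sum>t\<le>2*n. Y t + X t)"
    by (simp add: vsing_def act_sum act_scl s_mword vs.scale_right_distrib vs.scale_right_diff_distrib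
        X_def Y_def algebra_simps)
  also have "\<dots> = (\<Sum>t<2*n. Y (Suc t) + X t) + X (2 * n)"
    by (rule sum_shift) (simp add: Y_def)
  also have "X (2 * n) = 0"
    by (simp add: X_def)
  also have "(\<Sum>t<2*n. Y (Suc t) + X t) + 0 = (\<Sum>t<2*n. scl (1 / fact t)
      (scl (of_nat n - 2) (mword n t (2 * n - t - 1) (Suc t)) - level (mword n t (2 * n - t - 1) (Suc t))))"
  proof (simp only: add_0_right, rule sum.cong[OF refl])
    fix t assume "t \<in> {..<2*n}"
    then have t: "of_nat (2 * n - t) = (2 * of_nat n - of_nat t :: complex)"
        "of_nat (2 * n - Suc t) = (2 * of_nat n - of_nat t - 1 :: complex)"
      by (simp_all add: of_nat_diff)
    define q where "q = mword n t (2 * n - t - 1) (Suc t)"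
    have a: "1 / fact (Suc t) * of_nat (Suc t) = (1 / fact t :: complex)"
      by (simp add: field_simps del: of_nat_Suc)
    have "Y (Suc t) = scl (1 / fact (Suc t) * of_nat (Suc t))
        (scl (of_nat n + of_nat (2 * n - Suc t) - 1) q - level q)"
      by (simp add: Y_def q_def vs.scale_right_diff_distrib mult.assoc del: of_nat_Suc fact_Suc)
    also have "\<dots> = scl (1 / fact t) (scl (3 * of_nat n - of_nat t - 2) q - level q)"
      unfolding a t by (simp add: algebra_simps)
    finally have "Y (Suc t) + X t = scl (1 / fact t)
        (scl (3 * of_nat n - of_nat t - 2) q + scl (- (2 * of_nat n - of_nat t)) q - level q)"
      unfolding X_def q_def[symmetric] t
      by (simp add: vs.scale_right_distrib vs.scale_right_diff_distrib)
    then show "Y (Suc t) + X t = scl (1 / fact t) (scl (of_nat n - 2) (mword n t (2 * n - t - 1) (Suc t))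
        - level (mword n t (2 * n - t - 1) (Suc t)))"
      unfolding vs.scale_left_distrib[symmetric] q_def[symmetric] by simp
  qed
  finally show ?thesis
    by (simp add: zero_at_sum zero_at_scl zero_at_level)
qed

lemma cls_v2: "cls (v2 n) = vsing n"
  unfolding v2_def vsing_def
  by (subst cls_lincomb) (simp_all add: mword_def hw_def foldr_replicate atMost_atLeast0)

text \<open>Passing from \<open>t\<close> to \<open>t + 1\<close> trades one \<open>e23\<close> for
  \<open>e13\<close> and \<open>f12\<close>, and the root of \<open>e23\<close> is the sum of the
  other two.\<close>

lemma weight_vsing:
  assumes "h \<in> cartan"
  shows "act (G h 0) (vsing n) =
    scl (of_nat n * (h$0$0 - h$1$1) + 2 * of_nat n * (h$1$1 - h$2$2)) (vsing n)"
  unfolding vsing_def act_sum vs.scale_sum_right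
proof (rule sum.cong[OF refl])
  fix t assume "t \<in> {..2*n}"
  then have t: "of_nat (2 * n - t) = (2 * of_nat n - of_nat t :: complex)"
    by (simp add: of_nat_diff)
  have c: "of_nat n * (h$0$0 - h$1$1) + of_nat t * (h$1$1 - h$0$0)
      + of_nat (2 * n - t) * (h$1$1 - h$2$2) + of_nat t * (h$0$0 - h$2$2) =
      of_nat n * (h$0$0 - h$1$1) + 2 * of_nat n * (h$1$1 - h$2$2)"
    unfolding t by (simp add: algebra_simps)
  show "act (G h 0) (scl (1 / fact t) (mword n t (2 * n - t) t)) =
      scl (of_nat n * (h$0$0 - h$1$1) + 2 * of_nat n * (h$1$1 - h$2$2))
        (scl (1 / fact t) (mword n t (2 * n - t) t))"
    unfolding act_scl weight_mword[OF assms] c vs.scale_scale by (simp only: mult.commute)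
qed

section \<open>Generation of the positive part by three elements\<close>

lemma zero_at_bracket:
  assumes "zero_at k (act (G x m) v)" "zero_at k (act (G y n) v)" "lbr x y = msc c z" "c \<noteq> 0"
    and "x \<in> sl3" "y \<in> sl3" "z \<in> sl3" "m + n \<noteq> 0 \<or> m = 0"
  shows "zero_at k (act (G z (m + n)) v)"
proof -
  have "scl c (act (G z (m + n)) v) = act (G x m) (act (G y n) v) + scl (-1) (act (G y n) (act (G x m) v))"
    using act_bracket_simple[OF assms(5,6,7,3), of m n v] assms(8) by auto
  then have "zero_at k (scl c (act (G z (m + n)) v))"
    using assms(1,2) by (simp only: zero_at_add zero_at_scl zero_at_act)
  from zero_at_scl[OF this, of "1 / c"] show ?thesis
    using assms(4) by simp
qed

lemma zero_at_lincomb: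
  assumes "zero_at k (act (G x m) v)" "zero_at k (act (G y m) v)" "x \<in> sl3" "y \<in> sl3"
  shows "zero_at k (act (G (msc a x + msc b y) m) v)"
  using assms by (simp add: act_lincomb zero_at_add zero_at_scl)

text \<open>The nesting uses binary combinations \<open>msc a x + msc b y\<close>, the shape to
  which \<open>zero_at_lincomb\<close> applies.\<close>

lemma sl3_decomp:
  assumes "x \<in> sl3"
  shows "x = msc 1 (msc (x$0$1) (Emat 0 1) + msc (x$0$2) (Emat 0 2))
    + msc 1 (msc 1 (msc (x$1$0) (Emat 1 0) + msc (x$1$2) (Emat 1 2))
    + msc 1 (msc 1 (msc (x$2$0) (Emat 2 0) + msc (x$2$1) (Emat 2 1))
    + msc 1 (msc (x$0$0) (hdiff 0 1) + msc (x$0$0 + x$1$1) (hdiff 1 2))))"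
proof -
  have "x$2$2 = - x$0$0 - x$1$1"
    using assms by (simp add: sl3_def trace_def sum_3 eq_neg_iff_add_eq_0 algebra_simps)
  then show ?thesis
    by (simp add: mat3_simps)
qed

lemma zero_at_sl3:
  assumes "\<And>i j. i \<noteq> j \<Longrightarrow> zero_at k (act (G (Emat i j) m) v)"
    and "zero_at k (act (G (hdiff 0 1) m) v)" "zero_at k (act (G (hdiff 1 2) m) v)" "x \<in> sl3"
  shows "zero_at k (act (G x m) v)"
  by (subst sl3_decomp[OF assms(4)])
     (intro zero_at_lincomb sl3_lincomb assms in_sl3; simp)

lemma Emat_mult: "Emat i l ** Emat l' j = (if l = l' then Emat i j else 0)"
proof -
  have "(\<Sum>c\<in>UNIV. Emat i l $ a $ c * Emat l' j $ c $ b) =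
      (\<Sum>c\<in>UNIV. if c = l then if a = i \<and> l = l' \<and> b = j then 1 else 0 else 0)" for a b
    by (intro sum.cong) (auto simp: Emat_nth)
  then show ?thesis
    by (simp add: vec_eq_iff matrix_matrix_mult_def Emat_nth)
qed

text \<open>\<open>sl3\<close> is its own derived algebra: off-diagonal units are brackets through a
  third index, and diagonal differences are brackets of opposite units. No central term arises since
  \<open>m + n \<noteq> 0\<close>.\<close>

lemma sl3_bracket_closed:
  assumes "\<And>x. x \<in> sl3 \<Longrightarrow> zero_at k (act (G x m) v)" "\<And>x. x \<in> sl3 \<Longrightarrow> zero_at k (act (G x n) v)"
    and "m + n \<noteq> 0" "x \<in> sl3"
  shows "zero_at k (act (G x (m + n)) v)"
proof -
  have br: "zero_at k (act (G z (m + n)) v)" if "x \<in> sl3" "y \<in> sl3" "z \<in> sl3" "lbr x y = msc 1 z" for x y z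
    using zero_at_bracket[OF assms(1)[OF that(1)] assms(2)[OF that(2)] that(4)] that assms(3) by simp
  have E: "zero_at k (act (G (Emat i j) (m + n)) v)" if "i \<noteq> j" for i j :: 3
  proof -
    have "card {i, j} < CARD(3)"
      using card_insert_le_m1[of 2 "{j}" i] by simp
    then have "{i, j} \<noteq> UNIV"
      by auto
    then obtain l :: 3 where l: "l \<noteq> i" "l \<noteq> j"
      by blast
    have "lbr (Emat i l) (Emat l j) = msc 1 (Emat i j)"
      using that l by (simp add: lbr_def Emat_mult vec_eq_iff msc_nth)
    with l that show ?thesis
      by (intro br[of "Emat i l" "Emat l j"] in_sl3) auto
  qed
  have H: "zero_at k (act (G (hdiff i j) (m + n)) v)" if "(i, j) = (0, 1) \<or> (i, j) = (1, 2)" for i j :: 3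
  proof (rule br[of "Emat i j" "Emat j i"])
    show "lbr (Emat i j) (Emat j i) = msc 1 (hdiff i j)"
      by (simp add: lbr_def Emat_mult hdiff_def vec_eq_iff msc_nth)
  qed (use that in \<open>auto simp: in_sl3\<close>)
  show ?thesis
    by (rule zero_at_sl3) (use E H assms(4) in auto)
qed

lemma three_le [simp]: "(0::3) \<le> 1" "(0::3) \<le> 2" "(1::3) \<le> 2"
  by (simp_all add: less_eq_bit1_def bit1.Rep_numeral bit1.Rep_0 bit1.Rep_1)

lemma nplus_decomp:
  assumes "x \<in> nplus"
  shows "x = msc 1 (msc (x$0$1) (Emat 0 1) + msc (x$0$2) (Emat 0 2)) + msc (x$1$2) (Emat 1 2)"
  using assms by (simp add: nplus_def mat3_simps)

theorem theorem6p1: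
  fixes n :: nat
  assumes "n \<ge> 1"
  shows "singular_vector (of_int (int n - 2)) (v2 n)"
proof -
  define k :: complex where "k = of_nat n - 2"
  define S where "S x m \<longleftrightarrow> zero_at k (act (G x m) (vsing n))" for x m
  have fin: "fin (v2 n)"
    unfolding v2_def by (rule fin_lincomb) simp
  have S_iff: "fmul (gm x m) (v2 n) \<in> Nid k \<longleftrightarrow> S x m" for x m
    using zero_at_cls[of "fmul (gm x m) (v2 n)" k] fin
    by (simp add: S_def gm_def cls_fmul cls_v2)
  have wt: "fsub (fmul (gm h 0) (v2 n))
      (fsmul (of_nat n * (h$0$0 - h$1$1) + 2 * of_nat n * (h$1$1 - h$2$2)) (v2 n)) \<in> Nid k"
    if "h \<in> cartan" for h
    using fin weight_vsing[OF that, of n]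
    by (subst zero_at_cls[symmetric]) (simp_all add: cls_fsub cls_fsmul gm_def cls_fmul cls_v2)
  have br: "S z (m + m')"
    if "S x m" "S y m'" "lbr x y = msc c z" "c \<noteq> 0" "x \<in> sl3" "y \<in> sl3" "z \<in> sl3" "m + m' \<noteq> 0 \<or> m = 0"
    for x y z c m m'
    using zero_at_bracket[of k x m "vsing n" y m' c z] that by (simp add: S_def)
  have e: "S (Emat 0 1) 0" and g: "S (Emat 1 2) 0"
    using e_vsing[of n] g_vsing[of n] by (simp_all add: S_def e12_def e23_def)
  have E02: "S (Emat 0 2) 0"
    using br[OF e g, of 1 "Emat 0 2"] by (simp add: in_sl3) (simp add: mat3_simps)
  have nplus: "S x 0" if "x \<in> nplus" for x
    unfolding S_def
    by (subst nplus_decomp[OF that], intro zero_at_lincomb sl3_lincomb)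
       (use e g E02 in \<open>simp_all add: S_def in_sl3\<close>)
  have s: "S (Emat 2 0) 1"
    using s_vsing[of n] by (simp add: S_def k_def)
  \<comment> \<open>From the lowest root vector in degree 1, brackets with \<open>e12(0)\<close> and
    \<open>e23(0)\<close> climb through the whole adjoint representation.\<close>
  have E21: "S (Emat 2 1) 1"
    using br[OF e s, of "-1" "Emat 2 1"] by (simp add: in_sl3) (simp add: mat3_simps)
  have E10: "S (Emat 1 0) 1"
    using br[OF g s, of 1 "Emat 1 0"] by (simp add: in_sl3) (simp add: mat3_simps)
  have H01: "S (hdiff 0 1) 1"
    using br[OF e E10, of 1 "hdiff 0 1"] by (simp add: in_sl3) (simp add: mat3_simps)
  have H12: "S (hdiff 1 2) 1"
    using br[OF g E21, of 1 "hdiff 1 2"] by (simp add: in_sl3) (simp add: mat3_simps)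
  have E01: "S (Emat 0 1) 1"
    using br[OF e H01, of "-2" "Emat 0 1"] by (simp add: in_sl3) (simp add: mat3_simps)
  have E12: "S (Emat 1 2) 1"
    using br[OF g H12, of "-2" "Emat 1 2"] by (simp add: in_sl3) (simp add: mat3_simps)
  have E02': "S (Emat 0 2) 1"
    using br[OF e E12, of 1 "Emat 0 2"] by (simp add: in_sl3) (simp add: mat3_simps)
  have 1: "S x 1" if "x \<in> sl3" for x
  proof -
    have "S (Emat i j) 1" if "i \<noteq> j" for i j
      using that exhaust_3[of i] exhaust_3[of j] s E21 E10 E01 E12 E02' by auto
    then show ?thesis
      using H01 H12 that zero_at_sl3[of k 1 "vsing n" x] by (simp add: S_def)
  qed
  \<comment> \<open>Each further degree is reached by bracketing with degree 1.\<close>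
  have pos: "S x (int m + 1)" if "x \<in> sl3" for x m
    using that
  proof (induction m arbitrary: x)
    case 0
    then show ?case using 1 by simp
  next
    case (Suc m)
    have "S x (1 + (int m + 1))"
      using sl3_bracket_closed[of k 1 "vsing n" "int m + 1" x] 1 Suc unfolding S_def by simp
    then show ?case by (simp add: algebra_simps)
  qed
  have all: "S x m" if "x \<in> sl3" "m \<ge> 1" for x m
    using pos[OF that(1), of "nat (m - 1)"] that(2) by simp
  have k: "of_int (int n - 2) = k"
    by (simp add: k_def)
  show ?thesis
    unfolding k singular_vector_def S_iff
  proof (intro conjI exI ballI allI impI)
    show "fin (v2 n)" by (rule fin)
    show "v2 n \<notin> Nid k" by (rule v2_notin_Nid)
  qed (blast intro: wt nplus all)+
qed

end
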